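(* Let $\pi\in\mathbb{A}_n$ and let $\rho$ be an irreducible complex representation of the centralizer $\mathbb{A}_n^{\pi}$ of $\pi$ in $\mathbb{A}_n$. Assume that $\pi$ is neither $(1\,2\,3)$ nor $(1\,3\,2)$ in $\mathbb{A}_4$. Let $\mathcal{O}_\pi$ be the conjugacy class of $\pi$ in $\mathbb{A}_n$. If $\dim\mathfrak{B}(\mathcal{O}_\pi,\rho)<\infty$, then $\pi$ has even order and $q_{\pi\pi}=-1$, where $q_{\pi\pi}$ is the scalar by which $\rho(\pi)$ acts.
   Context: $\mathbb{A}_n$ denotes the alternating group on $n$ letters. Let $G$ be a finite group, $s\in G$, $\mathcal{O}$ the conjugacy class of $s$ in $G$, $G^s$ the centralizer of $s$ in $G$, and $\rho:G^s\to GL(V)$ an irreducible complex representation. Since $s$ is central in $G^s$, by Schur's Lemma $\rho(s)$ is a scalar, denoted $q_{ss}$. List $\mathcal{O}=\{t_1=s,\dots,t_M\}$ and choose $g_i\in G$ with $g_isg_i^{-1}=t_i$. The irreducible Yetter-Drinfeld module $M(\mathcal{O},\rho)=\bigoplus_{i=1}^M g_i\otimes V$ over $\mathbb{C}G$ has, writing $g_iv:=g_i\otimes v$, coaction $\delta(g_iv)=t_i\otimes g_iv$ and action $g\cdot(g_iv)=g_j(\gamma\cdot v)$, where $gg_i=g_j\gamma$ with $\gamma\in G^s$. It is a braided vector space with braiding $c(g_iv\otimes g_jw)=t_i\cdot(g_jw)\otimes g_iv$. $\mathfrak{B}(\mathcal{O},\rho)$ denotes the Nichols algebra of this braided vector space.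 Here $G=\mathbb{A}_n$ and $s=\pi$.
   Formalization: The 3-cycles of A_3 are also excluded: there a faithful character gives a Nichols algebra of dimension 3 although the order is odd; and "neither (1 2 3) nor (1 3 2) in A_4" is read up to conjugacy in A_4, so all 3-cycles of A_4 are excluded. *)

theory Defs
  imports
    "HOL-Analysis.Cartesian_Space"
    "HOL-Algebra.Sym_Groups"
    "HOL-Algebra.Multiplicative_Group"
    "HOL-Library.Poly_Mapping"
begin

section \<open>Conjugacy classes, centralizers, representations\<close>

definition conj_class :: "('g, 'm) monoid_scheme \<Rightarrow> 'g \<Rightarrow> 'g set" where
  "conj_class G s = {g \<otimes>\<^bsub>G\<^esub> s \<otimes>\<^bsub>G\<^esub> inv\<^bsub>G\<^esub> g | g. g \<in> carrier G}"

definition centralizer :: "('g, 'm) monoid_scheme \<Rightarrow> 'g \<Rightarrow> 'g set" where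
  "centralizer G s = {x \<in> carrier G. x \<otimes>\<^bsub>G\<^esub> s = s \<otimes>\<^bsub>G\<^esub> x}"

definition GL :: "(complex^'d^'d) monoid" where
  "GL = \<lparr>carrier = {A. invertible A}, mult = (**), one = mat 1\<rparr>"

text \<open>Representations on the complex space \<open>complex^'d\<close>; it is nonzero because index types
  are nonempty, as the notion of irreducibility requires.\<close>

definition irreducible_rep :: "('g, 'm) monoid_scheme \<Rightarrow> ('g \<Rightarrow> complex^'d^'d) \<Rightarrow> bool" where
  "irreducible_rep H \<rho> \<longleftrightarrow> \<rho> \<in> hom H GL \<and>
     (\<forall>W. vec.subspace W \<and> (\<forall>h\<in>carrier H. \<forall>v\<in>W. \<rho> h *v v \<in> W) \<longrightarrow> W = {0} \<or> W = UNIV)"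

text \<open>The scalar by which a matrix acts; by Schur's Lemma it exists for \<open>\<rho> s\<close> when \<open>\<rho>\<close> is an
  irreducible representation of the centralizer of \<open>s\<close>.\<close>

definition acting_scalar :: "complex^'d^'d \<Rightarrow> complex" where
  "acting_scalar A = (THE q. \<forall>v. A *v v = q *s v)"


section \<open>Free vector spaces\<close>

text \<open>\<open>'b \<Rightarrow>\<^sub>0 complex\<close> is the complex vector space with basis \<open>'b\<close>, the basis vector of \<open>b\<close> being
  \<open>Poly_Mapping.single b 1\<close>.\<close>

definition cscale :: "complex \<Rightarrow> ('b \<Rightarrow>\<^sub>0 complex) \<Rightarrow> ('b \<Rightarrow>\<^sub>0 complex)" where
  "cscale a = Poly_Mapping.map ((*) a)"

lemma lookup_cscale [simp]: "Poly_Mapping.lookup (cscale a f) b = a * Poly_Mapping.lookup f b"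
  by (auto simp: cscale_def Poly_Mapping.map.rep_eq when_def)

interpretation free_vs: vector_space cscale
  by unfold_locales
    (auto intro!: poly_mapping_eqI simp: lookup_add algebra_simps)

definition lin_ext :: "('b \<Rightarrow> ('c \<Rightarrow>\<^sub>0 complex)) \<Rightarrow> ('b \<Rightarrow>\<^sub>0 complex) \<Rightarrow> ('c \<Rightarrow>\<^sub>0 complex)" where
  "lin_ext \<phi> f = (\<Sum>b\<in>Poly_Mapping.keys f. cscale (Poly_Mapping.lookup f b) (\<phi> b))"


section \<open>The Nichols algebra of a braided vector space\<close>

text \<open>A finite-dimensional braided vector space \<open>V\<close> is given by a finite basis \<open>X\<close> and by the
  values \<open>c x y\<close> of the braiding on \<open>x \<otimes> y\<close>, for \<open>x\<close> and \<open>y\<close> in \<open>X\<close>; the basis tensor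
  \<open>a \<otimes> b\<close> of \<open>V \<otimes> V\<close> is the pair \<open>(a, b)\<close>. The basis of the tensor algebra \<open>T(V)\<close> is the set of
  words over \<open>X\<close>, and words of length \<open>m\<close> form a basis of its \<open>m\<close>-th component.\<close>

type_synonym 'x braiding = "'x \<Rightarrow> 'x \<Rightarrow> ('x \<times> 'x \<Rightarrow>\<^sub>0 complex)"

definition tensor_algebra :: "'x set \<Rightarrow> ('x list \<Rightarrow>\<^sub>0 complex) set" where
  "tensor_algebra X = {f. Poly_Mapping.keys f \<subseteq> lists X}"

definition tensor_power :: "'x set \<Rightarrow> nat \<Rightarrow> ('x list \<Rightarrow>\<^sub>0 complex) set" where
  "tensor_power X m = {f \<in> tensor_algebra X. \<forall>w\<in>Poly_Mapping.keys f. length w = m}"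

text \<open>\<open>braid_at c i\<close> applies \<open>c\<close> to the tensor factors in positions \<open>i\<close> and \<open>i + 1\<close>, counted
  from 0.\<close>

definition braid_at :: "'x braiding \<Rightarrow> nat \<Rightarrow> ('x list \<Rightarrow>\<^sub>0 complex) \<Rightarrow> ('x list \<Rightarrow>\<^sub>0 complex)" where
  "braid_at c i =
     lin_ext (\<lambda>w. lin_ext (\<lambda>(a, b). Poly_Mapping.single (w[i := a, Suc i := b]) 1)
                          (c (w ! i) (w ! Suc i)))"

definition perm_of_word :: "nat list \<Rightarrow> nat \<Rightarrow> nat" where
  "perm_of_word is = foldr (\<lambda>i p. Transposition.transpose i (Suc i) \<circ> p) is id"

definition reduced_word :: "nat \<Rightarrow> (nat \<Rightarrow> nat) \<Rightarrow> nat list \<Rightarrow> bool" where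
  "reduced_word m \<sigma> is \<longleftrightarrow>
     (\<forall>i\<in>set is. Suc i < m) \<and> perm_of_word is = \<sigma> \<and>
     (\<forall>js. (\<forall>i\<in>set js. Suc i < m) \<and> perm_of_word js = \<sigma> \<longrightarrow> length is \<le> length js)"

text \<open>The Matsumoto lift of a permutation of \<open>{..<m}\<close> to the braid group, acting on the \<open>m\<close>-th
  tensor power. As \<open>c\<close> satisfies the braid equation, it does not depend on the reduced word.\<close>

definition matsumoto_lift ::
  "'x braiding \<Rightarrow> nat \<Rightarrow> (nat \<Rightarrow> nat) \<Rightarrow> ('x list \<Rightarrow>\<^sub>0 complex) \<Rightarrow> ('x list \<Rightarrow>\<^sub>0 complex)" where
  "matsumoto_lift c m \<sigma> = foldr (\<lambda>i h. braid_at c i \<circ> h) (SOME is. reduced_word m \<sigma> is) id"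

definition quantum_symmetrizer ::
  "'x braiding \<Rightarrow> nat \<Rightarrow> ('x list \<Rightarrow>\<^sub>0 complex) \<Rightarrow> ('x list \<Rightarrow>\<^sub>0 complex)" where
  "quantum_symmetrizer c m f = (\<Sum>\<sigma> | \<sigma> permutes {..<m}. matsumoto_lift c m \<sigma> f)"

text \<open>The Nichols algebra of \<open>(V, c)\<close> is \<open>T(V) / J\<close>, where the ideal \<open>J\<close> is the direct sum over
  \<open>m\<close> of the kernels of the quantum symmetrizers on the \<open>m\<close>-th tensor powers. The summands with
  \<open>m \<le> 1\<close> vanish, the symmetrizer being the identity there.\<close>

definition nichols_ideal :: "'x set \<Rightarrow> 'x braiding \<Rightarrow> ('x list \<Rightarrow>\<^sub>0 complex) set" where
  "nichols_ideal X c =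
     free_vs.span (\<Union>m. {f \<in> tensor_power X m. quantum_symmetrizer c m f = 0})"

text \<open>\<open>T(V) / J\<close> has finite dimension: it is spanned by the classes of finitely many tensors.\<close>

definition nichols_finite_dim :: "'x set \<Rightarrow> 'x braiding \<Rightarrow> bool" where
  "nichols_finite_dim X c \<longleftrightarrow>
     (\<exists>B. finite B \<and> B \<subseteq> tensor_algebra X \<and>
          tensor_algebra X \<subseteq> free_vs.span (B \<union> nichols_ideal X c))"


section \<open>The Yetter-Drinfeld module of a conjugacy class and a representation\<close>

text \<open>The conjugacy class of \<open>s\<close> is indexed by itself: for \<open>t\<close> in it, \<open>g t\<close> is the chosen element
  conjugating \<open>s\<close> to \<open>t\<close>. The pair \<open>(t, k)\<close> stands for the basis vector \<open>g t \<otimes> e\<^sub>k\<close>, where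
  \<open>e\<^sub>k\<close> is the \<open>k\<close>-th standard basis vector of \<open>complex^'d\<close>.\<close>

definition conj_section :: "('g, 'm) monoid_scheme \<Rightarrow> 'g \<Rightarrow> ('g \<Rightarrow> 'g) \<Rightarrow> bool" where
  "conj_section G s g \<longleftrightarrow>
     (\<forall>t\<in>conj_class G s. g t \<in> carrier G \<and> g t \<otimes>\<^bsub>G\<^esub> s \<otimes>\<^bsub>G\<^esub> inv\<^bsub>G\<^esub> (g t) = t)"

definition yd_basis :: "('g, 'm) monoid_scheme \<Rightarrow> 'g \<Rightarrow> ('g \<times> 'd) set" where
  "yd_basis G s = conj_class G s \<times> UNIV"

text \<open>\<open>h\<close> maps \<open>g t \<otimes> v\<close> to \<open>g u \<otimes> \<rho> \<gamma> v\<close>, for the unique \<open>u\<close> such that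
  \<open>h (g t) = (g u) \<gamma>\<close> with \<open>\<gamma>\<close> in the centralizer of \<open>s\<close>; the sum below has only one nonzero
  term.\<close>

definition yd_action ::
  "('g, 'm) monoid_scheme \<Rightarrow> 'g \<Rightarrow> ('g \<Rightarrow> complex^'d^'d) \<Rightarrow> ('g \<Rightarrow> 'g) \<Rightarrow>
     'g \<Rightarrow> 'g \<times> 'd \<Rightarrow> ('g \<times> 'd \<Rightarrow>\<^sub>0 complex)" where
  "yd_action G s \<rho> g h = (\<lambda>(t, k).
     \<Sum>u\<in>conj_class G s.
       let \<gamma> = inv\<^bsub>G\<^esub> (g u) \<otimes>\<^bsub>G\<^esub> h \<otimes>\<^bsub>G\<^esub> g t
       in if \<gamma> \<in> centralizer G s
          then \<Sum>l\<in>UNIV. Poly_Mapping.single (u, l) (\<rho> \<gamma> $ l $ k)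
          else 0)"

text \<open>\<open>c(x \<otimes> y) = (t \<cdot> y) \<otimes> x\<close> for basis vectors \<open>x\<close>, \<open>y\<close>, where \<open>t = fst x\<close> is the degree of
  \<open>x\<close>.\<close>

definition yd_braiding ::
  "('g, 'm) monoid_scheme \<Rightarrow> 'g \<Rightarrow> ('g \<Rightarrow> complex^'d^'d) \<Rightarrow> ('g \<Rightarrow> 'g) \<Rightarrow> ('g \<times> 'd) braiding" where
  "yd_braiding G s \<rho> g x y =
     lin_ext (\<lambda>z. Poly_Mapping.single (z, x) 1) (yd_action G s \<rho> g (fst x) y)"

end

theory Submission
  imports Defs "HOL-Analysis.Complex_Transcendental" "HOL-Number_Theory.Cong"
begin

text \<open>The coefficients of the quantum symmetrizer of a diagonal braiding are iterated skew
  derivatives. If \<open>z\<close> is an iterated braided commutator of distinct letters whose degree has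
  self-braiding 1, then a suitable product of skew derivations maps \<open>z ^ r\<close> to \<open>r!\<close> times the
  \<open>r\<close>-th power of a nonzero constant, so \<open>z ^ r\<close> is nonzero in the Nichols algebra for all \<open>r\<close>.

  Let \<open>q\<close> be the scalar of \<open>\<pi>\<close>. The vectors of degree \<open>\<pi> ^ i\<close>, for those \<open>\<pi> ^ i\<close> that are
  conjugate to \<open>\<pi>\<close>, span a diagonal braided subspace in which the braiding of \<open>\<pi> ^ i\<close> and \<open>\<pi> ^ j\<close>
  is \<open>q ^ (i / j)\<close>. If \<open>\<pi>\<close> is conjugate to its inverse and \<open>q\<^sup>2 \<noteq> 1\<close>, the sum of the degrees of
  \<open>\<pi>\<close> and its inverse has self-braiding 1. Otherwise \<open>\<pi>\<close> commutes with no odd permutation, so it has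
  odd order, which is not 3 by the excluded cases, and it is conjugate to \<open>\<pi>\<^sup>2\<close> or to \<open>\<pi> ^ (-2)\<close>;
  degrees with self-braiding 1 are then found among the nonnegative combinations of the degrees of
  \<open>\<pi>\<close>, \<open>\<pi> ^ (\<plusminus>2)\<close> and \<open>\<pi>\<^sup>4\<close>.\<close>

section \<open>Free algebras\<close>

text \<open>Self-braiding 1 is wanted because the Leibniz rule on \<open>z ^ r\<close> produces the
  sum of the first \<open>r\<close> powers of that self-braiding, which is then the nonzero integer
  \<open>r\<close>. The delicate point is the constant: it is a product of quantum integers and of
  factors 1 minus a root of unity, and the case distinctions on the order of \<open>q\<close> keep
  all of them nonzero.

  The exponent \<open>i / j\<close> comes from transport to the base point: an element carrying
  \<open>\<pi>\<close> to \<open>\<pi> ^ j\<close> by conjugation carries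
  \<open>\<pi> ^ (i / j)\<close> to \<open>\<pi> ^ i\<close>, and \<open>\<rho>\<close> maps the
  former to the scalar \<open>q ^ (i / j)\<close>.

  The conjugacies are a matter of parity. In the symmetric group \<open>\<pi>\<close> is conjugate
  to each power prime to its order, and an odd permutation commuting with \<open>\<pi>\<close> can
  correct the sign of a conjugating one. If there is none, the order is odd, since a cycle of
  \<open>\<pi>\<close> of even length would be such a permutation. If moreover the permutation
  inverting \<open>\<pi>\<close> is odd, then either a permutation squaring \<open>\<pi>\<close> is
  even or its product with the inverting one is, which gives exponent 2 or -2.\<close>

lemma poly_mapping_eq_sum_single:
  "f = (\<Sum>b\<in>Poly_Mapping.keys f. Poly_Mapping.single b (Poly_Mapping.lookup f b))"
  by (rule poly_mapping_eqI)
    (simp add: lookup_sum lookup_single when_def in_keys_iff)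

lemma poly_mapping_additive_induct [case_names single add]:
  assumes "\<And>b a. P (Poly_Mapping.single b a)" and "\<And>f g. P f \<Longrightarrow> P g \<Longrightarrow> P (f + g)"
  shows "P (f :: 'b \<Rightarrow>\<^sub>0 'a::comm_monoid_add)"
proof -
  have "P 0"
    using assms(1)[of undefined 0] by simp
  have "P (\<Sum>b\<in>B. Poly_Mapping.single b (Poly_Mapping.lookup f b))" if "finite B" for B
    using that by (induction B rule: finite_induct) (auto intro: assms \<open>P 0\<close>)
  then show ?thesis
    by (subst poly_mapping_eq_sum_single) simp
qed

lemma lin_ext_superset:
  assumes "finite A" "Poly_Mapping.keys f \<subseteq> A"
  shows "lin_ext \<phi> f = (\<Sum>b\<in>A. cscale (Poly_Mapping.lookup f b) (\<phi> b))"
  unfolding lin_ext_def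
  by (rule sum.mono_neutral_left) (use assms in \<open>auto simp: in_keys_iff\<close>)

lemma lin_ext_0 [simp]: "lin_ext \<phi> 0 = 0"
  by (simp add: lin_ext_def)

lemma lin_ext_add: "lin_ext \<phi> (f + g) = lin_ext \<phi> f + lin_ext \<phi> g"
proof -
  let ?A = "Poly_Mapping.keys f \<union> Poly_Mapping.keys g"
  have "Poly_Mapping.keys (f + g) \<subseteq> ?A"
    by (rule Poly_Mapping.keys_add)
  then have "lin_ext \<phi> (f + g) = (\<Sum>b\<in>?A. cscale (Poly_Mapping.lookup (f + g) b) (\<phi> b))"
    by (intro lin_ext_superset) auto
  also have "\<dots> = (\<Sum>b\<in>?A. cscale (Poly_Mapping.lookup f b) (\<phi> b))
      + (\<Sum>b\<in>?A. cscale (Poly_Mapping.lookup g b) (\<phi> b))"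
    by (simp add: lookup_add free_vs.scale_left_distrib sum.distrib)
  also have "\<dots> = lin_ext \<phi> f + lin_ext \<phi> g"
    by (simp add: lin_ext_superset[of ?A])
  finally show ?thesis .
qed

lemma lin_ext_single [simp]: "lin_ext \<phi> (Poly_Mapping.single b a) = cscale a (\<phi> b)"
  by (simp add: lin_ext_def)

lemma cscale_single [simp]:
  "cscale a (Poly_Mapping.single b a') = Poly_Mapping.single b (a * a')"
  by (rule poly_mapping_eqI) (simp add: lookup_single when_def)

lemma lin_ext_cscale: "lin_ext \<phi> (cscale a f) = cscale a (lin_ext \<phi> f)"
  by (induction f rule: poly_mapping_additive_induct)
    (simp_all add: free_vs.scale_right_distrib lin_ext_add)

lemma lin_ext_diff: "lin_ext \<phi> (f - g) = lin_ext \<phi> f - lin_ext \<phi> g"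
  by (metis add_diff_cancel_right' diff_add_cancel lin_ext_add)

lemma lin_ext_sum: "lin_ext \<phi> (sum F A) = (\<Sum>a\<in>A. lin_ext \<phi> (F a))"
  by (induction A rule: infinite_finite_induct) (auto simp: lin_ext_add)

text \<open>With concatenation as addition on words, the convolution product of poly mappings is the
  product of the tensor algebra.\<close>

instantiation list :: (type) monoid_add
begin

definition "0 = []"
definition "xs + ys = xs @ ys"

instance
  by standard (auto simp: zero_list_def plus_list_def)

end

lemma single_mult_single:
  "Poly_Mapping.single (u :: 'x list) a * Poly_Mapping.single v b = Poly_Mapping.single (u @ v) (a * b :: complex)"
  by (simp add: mult_single plus_list_def)

abbreviation scalar :: "complex \<Rightarrow> ('x list \<Rightarrow>\<^sub>0 complex)" where
  "scalar a \<equiv> Poly_Mapping.single [] a"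

abbreviation letter :: "'x \<Rightarrow> ('x list \<Rightarrow>\<^sub>0 complex)" where
  "letter x \<equiv> Poly_Mapping.single [x] 1"

lemma scalar_1: "scalar 1 = 1"
  by (metis single_one zero_list_def)

lemma scalar_mult: "scalar (a * b) = scalar a * scalar b"
  by (simp add: single_mult_single)

lemma scalar_sum: "scalar (sum F A) = (\<Sum>a\<in>A. scalar (F a))"
  by (induction A rule: infinite_finite_induct) (auto simp: single_add)

lemma scalar_central: "f * scalar a = scalar a * (f :: 'x list \<Rightarrow>\<^sub>0 complex)"
  by (induction f rule: poly_mapping_additive_induct)
    (simp_all add: single_mult_single distrib_left distrib_right mult.commute)

lemma scalar_left_commute: "f * (scalar a * g) = scalar a * (f * (g :: 'x list \<Rightarrow>\<^sub>0 complex))"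
  by (metis mult.assoc scalar_central)

lemma cscale_eq_scalar_mult: "cscale a f = scalar a * f"
  by (induction f rule: poly_mapping_additive_induct)
    (auto simp: free_vs.scale_right_distrib distrib_left single_mult_single)

lemma cscale_mult_right: "f * cscale a g = cscale a (f * (g :: 'x list \<Rightarrow>\<^sub>0 complex))"
  by (simp add: cscale_eq_scalar_mult scalar_left_commute)

lemma cscale_mult_left: "cscale a f * g = cscale a (f * (g :: 'x list \<Rightarrow>\<^sub>0 complex))"
  by (simp add: cscale_eq_scalar_mult mult.assoc)

text \<open>Collects all scalars in one outer \<open>cscale\<close>, where they are commuting
  complex numbers that \<open>ac_simps\<close> can reorder. \<open>cscale_single\<close> is switched
  off alongside, lest it absorb them into a monomial again.\<close>

lemmas cscale_normalize = cscale_eq_scalar_mult[symmetric] cscale_mult_left cscale_mult_right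

section \<open>Skew derivations\<close>

text \<open>The factor acquired when the letter \<open>i\<close> is braided past the whole word
  \<open>w\<close>.\<close>

definition word_char :: "('x \<Rightarrow> 'x \<Rightarrow> complex) \<Rightarrow> 'x \<Rightarrow> 'x list \<Rightarrow> complex" where
  "word_char Q i w = prod_list (map (Q i) w)"

text \<open>The action of the group-like element attached to the letter \<open>i\<close>; it twists
  the Leibniz rule below.\<close>

definition grading_action ::
  "('x \<Rightarrow> 'x \<Rightarrow> complex) \<Rightarrow> 'x \<Rightarrow> ('x list \<Rightarrow>\<^sub>0 complex) \<Rightarrow> ('x list \<Rightarrow>\<^sub>0 complex)" where
  "grading_action Q i = lin_ext (\<lambda>w. Poly_Mapping.single w (word_char Q i w))"

text \<open>Each occurrence of \<open>i\<close> is braided to the right end of the word and then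
  deleted, at the cost of \<open>word_char\<close> of the letters that it passes.\<close>

primrec skew_deriv_word ::
  "('x \<Rightarrow> 'x \<Rightarrow> complex) \<Rightarrow> 'x \<Rightarrow> 'x list \<Rightarrow> ('x list \<Rightarrow>\<^sub>0 complex)" where
  "skew_deriv_word Q i [] = 0"
| "skew_deriv_word Q i (x # w) = letter x * skew_deriv_word Q i w
     + (if x = i then Poly_Mapping.single w (word_char Q i w) else 0)"

definition skew_deriv ::
  "('x \<Rightarrow> 'x \<Rightarrow> complex) \<Rightarrow> 'x \<Rightarrow> ('x list \<Rightarrow>\<^sub>0 complex) \<Rightarrow> ('x list \<Rightarrow>\<^sub>0 complex)" where
  "skew_deriv Q i = lin_ext (skew_deriv_word Q i)"

lemma word_char_simps [simp]:
  "word_char Q i [] = 1" "word_char Q i (x # w) = Q i x * word_char Q i w"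
  "word_char Q i (u @ v) = word_char Q i u * word_char Q i v"
  by (auto simp: word_char_def)

lemma grading_action_add: "grading_action Q i (f + g) = grading_action Q i f + grading_action Q i g"
  and grading_action_diff: "grading_action Q i (f - g) = grading_action Q i f - grading_action Q i g"
  and grading_action_letter [simp]: "grading_action Q i (letter x) = scalar (Q i x) * letter x"
  and grading_action_scalar [simp]: "grading_action Q i (scalar a) = scalar a"
  and grading_action_1 [simp]: "grading_action Q i 1 = 1"
  and skew_deriv_0 [simp]: "skew_deriv Q i 0 = 0"
  and skew_deriv_add: "skew_deriv Q i (f + g) = skew_deriv Q i f + skew_deriv Q i g"
  and skew_deriv_diff: "skew_deriv Q i (f - g) = skew_deriv Q i f - skew_deriv Q i g"
  and skew_deriv_sum: "skew_deriv Q i (sum F A) = (\<Sum>a\<in>A. skew_deriv Q i (F a))"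
  and skew_deriv_letter: "skew_deriv Q i (letter x) = (if x = i then 1 else 0)"
  and skew_deriv_scalar [simp]: "skew_deriv Q i (scalar a) = 0"
  and skew_deriv_1 [simp]: "skew_deriv Q i 1 = 0"
  by (auto simp: grading_action_def skew_deriv_def lin_ext_add lin_ext_diff lin_ext_sum
      cscale_eq_scalar_mult single_mult_single scalar_1 simp flip: scalar_1)

lemma grading_action_mult:
  "grading_action Q i (f * g) = grading_action Q i f * grading_action Q i g"
proof (induction f rule: poly_mapping_additive_induct)
  case (single u a)
  then show ?case
    by (induction g rule: poly_mapping_additive_induct)
      (simp_all add: grading_action_add distrib_left,
       simp_all add: grading_action_def single_mult_single ac_simps)
qed (simp add: grading_action_add distrib_right)

lemma skew_deriv_word_append:
  "skew_deriv_word Q i (u @ v) = Poly_Mapping.single u 1 * skew_deriv_word Q i v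
     + skew_deriv_word Q i u * Poly_Mapping.single v (word_char Q i v)"
proof (induction u)
  case Nil
  then show ?case by (simp add: scalar_1)
next
  case (Cons x u)
  have "Poly_Mapping.single (x # u) 1 * f = letter x * (Poly_Mapping.single u 1 * f)" for f
    by (simp add: single_mult_single flip: mult.assoc)
  with Cons show ?case
    by (auto simp: algebra_simps single_mult_single)
qed

text \<open>The skew Leibniz rule: a letter deleted from \<open>f\<close> still has to be braided
  past \<open>g\<close>.\<close>

lemma skew_deriv_mult:
  "skew_deriv Q i (f * g) = f * skew_deriv Q i g + skew_deriv Q i f * grading_action Q i g"
proof (induction f rule: poly_mapping_additive_induct)
  case (single u a)
  show ?case
  proof (induction g rule: poly_mapping_additive_induct)
    case (single v b)
    have "grading_action Q i (Poly_Mapping.single v b)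
        = cscale b (Poly_Mapping.single v (word_char Q i v))"
      by (simp add: grading_action_def)
    moreover have "Poly_Mapping.single u a * f = cscale a (Poly_Mapping.single u 1 * f)" for f
      by (simp flip: cscale_mult_left)
    ultimately show ?case
      by (simp del: cscale_single add: skew_deriv_def single_mult_single skew_deriv_word_append
          cscale_mult_left cscale_mult_right free_vs.scale_right_distrib mult.commute)
  qed (simp add: skew_deriv_add grading_action_add algebra_simps)
qed (simp add: skew_deriv_add algebra_simps)

lemma skew_deriv_scalar_mult:
  "skew_deriv Q i (scalar a * f) = scalar a * skew_deriv Q i f"
  by (simp add: skew_deriv_mult)

text \<open>The head of the list acts first, so the list spells a word from its last letter
  backwards.\<close>

definition skew_derivs ::
  "('x \<Rightarrow> 'x \<Rightarrow> complex) \<Rightarrow> 'x list \<Rightarrow> ('x list \<Rightarrow>\<^sub>0 complex) \<Rightarrow> ('x list \<Rightarrow>\<^sub>0 complex)" where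
  "skew_derivs Q = fold (skew_deriv Q)"

lemma skew_derivs_simps [simp]:
  "skew_derivs Q [] f = f"
  "skew_derivs Q (i # is) f = skew_derivs Q is (skew_deriv Q i f)"
  "skew_derivs Q (is @ js) f = skew_derivs Q js (skew_derivs Q is f)"
  by (auto simp: skew_derivs_def)

lemma skew_derivs_linear:
  "skew_derivs Q is 0 = 0"
  "skew_derivs Q is (f - g) = skew_derivs Q is f - skew_derivs Q is g"
  "skew_derivs Q is (sum F A) = (\<Sum>a\<in>A. skew_derivs Q is (F a))"
  "skew_derivs Q is (scalar a * f) = scalar a * skew_derivs Q is f"
  by (induction "is" arbitrary: f g F)
    (auto simp: skew_deriv_diff skew_deriv_sum skew_deriv_scalar_mult)

lemma grading_action_power:
  assumes "grading_action Q i z = scalar \<kappa> * z"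
  shows "grading_action Q i (z ^ l) = scalar (\<kappa> ^ l) * z ^ l"
proof (induction l)
  case 0
  then show ?case by (simp add: scalar_1)
next
  case (Suc l)
  then show ?case
    by (simp add: grading_action_mult assms cscale_normalize del: cscale_single)
qed

lemma skew_deriv_power_eq_0:
  assumes "skew_deriv Q i z = 0"
  shows "skew_deriv Q i (z ^ l) = 0"
  by (induction l) (auto simp: skew_deriv_mult assms)

text \<open>Derivations that kill \<open>z\<close> act on the middle factor only; each gains its
  eigenvalue once for every \<open>z\<close> to the right.\<close>

lemma skew_derivs_between_powers:
  assumes "\<And>i. i \<in> set is \<Longrightarrow> skew_deriv Q i z = 0"
    and "\<And>i. i \<in> set is \<Longrightarrow> grading_action Q i z = scalar (\<kappa> i) * z"
  shows "skew_derivs Q is (z ^ k * u * z ^ l)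
    = scalar (prod_list (map \<kappa> is) ^ l) * (z ^ k * skew_derivs Q is u * z ^ l)"
  using assms
proof (induction "is" arbitrary: u)
  case Nil
  then show ?case by (simp add: scalar_1)
next
  case (Cons i "is")
  have "skew_deriv Q i (z ^ k * u * z ^ l) = z ^ k * skew_deriv Q i u * (scalar (\<kappa> i ^ l) * z ^ l)"
    using Cons.prems
    by (simp add: skew_deriv_mult skew_deriv_power_eq_0 grading_action_power[where \<kappa> = "\<kappa> i"])
  also have "\<dots> = scalar (\<kappa> i ^ l) * (z ^ k * skew_deriv Q i u * z ^ l)"
    by (rule scalar_left_commute)
  finally show ?case
    using Cons
    by (simp add: skew_derivs_linear power_mult_distrib scalar_mult mult.assoc)
qed

text \<open>One summand for each of the \<open>r + 1\<close> factors that the derivation may hit;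
  \<open>l\<close> counts the factors to its right.\<close>

lemma skew_deriv_power:
  assumes "grading_action Q b z = scalar \<kappa> * z"
  shows "skew_deriv Q b (z ^ Suc r)
    = (\<Sum>l\<le>r. scalar (\<kappa> ^ l) * (z ^ (r - l) * skew_deriv Q b z * z ^ l))"
proof (induction r)
  case 0
  then show ?case by (simp add: scalar_1)
next
  case (Suc r)
  have "skew_deriv Q b (z ^ Suc (Suc r))
      = z * skew_deriv Q b (z ^ Suc r) + skew_deriv Q b z * (scalar (\<kappa> ^ Suc r) * z ^ Suc r)"
    by (subst power_Suc) (simp only: skew_deriv_mult grading_action_power[OF assms])
  also have "z * skew_deriv Q b (z ^ Suc r)
      = (\<Sum>l\<le>r. scalar (\<kappa> ^ l) * (z ^ (Suc r - l) * skew_deriv Q b z * z ^ l))"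
    unfolding Suc sum_distrib_left
    by (intro sum.cong) (auto simp: cscale_normalize Suc_diff_le mult.assoc simp del: cscale_single)
  finally show ?case
    by (simp add: cscale_normalize mult.assoc del: cscale_single)
qed

text \<open>The degree of \<open>z\<close> is isotropic: its self-braiding, the product of the \<open>\<kappa> i\<close>, is 1.
  Hence the quantum integers arising from the Leibniz rule are ordinary integers and no power
  of \<open>z\<close> is annihilated.\<close>

lemma skew_derivs_isotropic_power:
  assumes act: "\<And>i. i \<in> set (b # is) \<Longrightarrow> grading_action Q i z = scalar (\<kappa> i) * z"
    and zero: "\<And>i. i \<in> set is \<Longrightarrow> skew_deriv Q i z = 0"
    and iso: "prod_list (map \<kappa> (b # is)) = 1"
    and e: "skew_derivs Q (b # is) z = scalar e"
  shows "skew_derivs Q (concat (replicate r (b # is))) (z ^ r) = scalar (fact r * e ^ r)"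
proof (induction r)
  case 0
  then show ?case by (simp add: scalar_1)
next
  case (Suc r)
  \<comment> \<open>The derivation by \<open>b\<close> opens one factor \<open>z\<close>; those by
    \<open>is\<close> kill the intact factors and reduce the opened one to \<open>e\<close>. With
    \<open>l\<close> factors on its right the weight is the \<open>l\<close>-th power of the
    self-braiding, so all \<open>r + 1\<close> positions contribute equally.\<close>
  have "skew_derivs Q (b # is) (z ^ Suc r) = (\<Sum>l\<le>r. scalar (\<kappa> b ^ l) *
      (scalar (prod_list (map \<kappa> is) ^ l) * (z ^ (r - l) * skew_derivs Q (b # is) z * z ^ l)))"
    unfolding skew_derivs_simps skew_deriv_power[OF act[OF list.set_intros(1)]] skew_derivs_linear
    by (intro sum.cong refl arg_cong2[of _ _ _ _ "(*)"] skew_derivs_between_powers)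
      (auto simp: zero act)
  also have "\<dots> = (\<Sum>l\<le>r. scalar ((\<kappa> b * prod_list (map \<kappa> is)) ^ l) *
      (scalar e * (z ^ (r - l) * z ^ l)))"
    unfolding e scalar_central[of _ e]
    by (simp add: cscale_normalize power_mult_distrib ac_simps del: cscale_single)
  also have "\<dots> = (\<Sum>l\<le>r. scalar e * z ^ r)"
    using iso by (intro sum.cong) (auto simp: scalar_1 simp flip: power_add)
  also have "\<dots> = scalar (of_nat (Suc r) * e) * z ^ r"
    by (simp add: zero_list_def scalar_mult mult.assoc flip: single_of_nat)
  finally show ?case
    by (simp only: replicate_Suc concat.simps skew_derivs_simps(3) skew_derivs_linear Suc)
      (simp add: single_mult_single algebra_simps)
qed


section \<open>Iterated braided commutators\<close>

primrec ad_power :: "('x \<Rightarrow> 'x \<Rightarrow> complex) \<Rightarrow> 'x \<Rightarrow> 'x \<Rightarrow> nat \<Rightarrow> ('x list \<Rightarrow>\<^sub>0 complex)" where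
  "ad_power Q a b 0 = letter b"
| "ad_power Q a b (Suc m) = letter a * ad_power Q a b m
     - scalar (Q a a ^ m * Q a b) * (ad_power Q a b m * letter a)"

text \<open>The \<open>q\<close>-factorial: the inner sum is the quantum integer of
  \<open>k + 1\<close>.\<close>

definition quantum_fact :: "complex \<Rightarrow> nat \<Rightarrow> complex" where
  "quantum_fact q n = (\<Prod>k<n. \<Sum>j\<le>k. q ^ j)"

text \<open>The factors known from quantum Serre relations; together with
  \<open>quantum_fact\<close> they decide whether \<open>ad_power\<close> survives in the Nichols
  algebra.\<close>

definition ad_coeff :: "('x \<Rightarrow> 'x \<Rightarrow> complex) \<Rightarrow> 'x \<Rightarrow> 'x \<Rightarrow> nat \<Rightarrow> complex" where
  "ad_coeff Q a b m = (\<Prod>k<m. 1 - Q a a ^ k * (Q a b * Q b a))"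

lemma grading_action_ad_power:
  "grading_action Q i (ad_power Q a b m) = scalar (Q i a ^ m * Q i b) * ad_power Q a b m"
proof (induction m)
  case (Suc m)
  let ?s = "scalar (Q i a ^ m * Q i b)" and ?y = "ad_power Q a b m"
    and ?t = "scalar (Q a a ^ m * Q a b)"
  have "grading_action Q i (ad_power Q a b (Suc m))
      = scalar (Q i a) * letter a * (?s * ?y) - ?t * (?s * ?y * (scalar (Q i a) * letter a))"
    by (simp add: grading_action_diff grading_action_mult Suc)
  also have "\<dots> = scalar (Q i a * (Q i a ^ m * Q i b)) * ad_power Q a b (Suc m)"
    by (simp add: cscale_normalize free_vs.scale_right_diff_distrib mult.assoc ac_simps
        del: cscale_single)
  finally show ?case
    by (simp add: mult.assoc)
qed simp

text \<open>The scalar in the commutator is the eigenvalue of the action of \<open>a\<close> on the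
  inner commutator, so the derivation by \<open>a\<close> cancels. The derivation by
  \<open>b\<close> turns both terms into powers of \<open>a\<close>, and each commutator adds one
  factor to \<open>ad_coeff\<close>.\<close>

lemma skew_deriv_ad_power:
  assumes "a \<noteq> b"
  shows "skew_deriv Q i (ad_power Q a b m)
    = (if i = b then scalar (ad_coeff Q a b m) * letter a ^ m else 0)"
proof (induction m)
  case 0
  then show ?case
    by (auto simp: skew_deriv_letter ad_coeff_def scalar_1)
next
  case (Suc m)
  consider "i = b" | "i = a" | "i \<noteq> a" "i \<noteq> b"
    by blast
  then show ?case
  proof cases
    case 1
    let ?c = "scalar (ad_coeff Q a b m)"
    have "skew_deriv Q b (ad_power Q a b (Suc m)) = letter a * (?c * letter a ^ m)
        - scalar (Q a a ^ m * Q a b) * (?c * letter a ^ m * (scalar (Q b a) * letter a))"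
      using Suc 1 assms
      by (simp add: skew_deriv_diff skew_deriv_mult skew_deriv_letter)
    also have "\<dots> = scalar (ad_coeff Q a b m * (1 - Q a a ^ m * (Q a b * Q b a)))
        * letter a ^ Suc m"
      by (simp add: cscale_normalize free_vs.scale_left_diff_distrib right_diff_distrib ac_simps
          power_commutes del: cscale_single)
    finally show ?thesis
      using 1 by (simp add: ad_coeff_def)
  next
    case 2
    with Suc assms show ?thesis
      by (simp add: skew_deriv_diff skew_deriv_mult skew_deriv_letter grading_action_ad_power)
  next
    case 3
    with Suc show ?thesis
      by (simp add: skew_deriv_diff skew_deriv_mult skew_deriv_letter)
  qed
qed

text \<open>Each derivation removes one copy of \<open>a\<close> with a quantum integer as weight
  and gains \<open>\<psi>\<close> in passing \<open>v\<close>.\<close>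

lemma skew_derivs_replicate:
  assumes "skew_deriv Q a u = 0" "skew_deriv Q a v = 0" "grading_action Q a v = scalar \<psi> * v"
  shows "skew_derivs Q (replicate n a) (u * letter a ^ n * v)
    = scalar (\<psi> ^ n * quantum_fact (Q a a) n) * (u * v)"
proof (induction n)
  case 0
  then show ?case by (simp add: quantum_fact_def scalar_1)
next
  case (Suc n)
  have "skew_deriv Q a (letter a ^ Suc n) = (\<Sum>l\<le>n. scalar (Q a a ^ l) * letter a ^ n)"
    by (subst skew_deriv_power[where \<kappa> = "Q a a"])
      (auto intro!: sum.cong simp: skew_deriv_letter simp flip: power_add)
  also have "\<dots> = scalar (\<Sum>l\<le>n. Q a a ^ l) * letter a ^ n"
    by (simp add: sum_distrib_right[symmetric] scalar_sum)
  finally have "skew_deriv Q a (letter a ^ Suc n) = scalar (\<Sum>l\<le>n. Q a a ^ l) * letter a ^ n" .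
  then have "skew_deriv Q a (u * letter a ^ Suc n * v)
      = u * (scalar (\<Sum>l\<le>n. Q a a ^ l) * letter a ^ n) * (scalar \<psi> * v)"
    using assms by (simp del: power_Suc add: skew_deriv_mult)
  also have "\<dots> = scalar (\<psi> * (\<Sum>l\<le>n. Q a a ^ l)) * (u * letter a ^ n * v)"
    by (simp add: cscale_normalize mult.assoc ac_simps del: cscale_single)
  finally show ?case
    by (simp add: skew_derivs_linear Suc del: power_Suc)
      (simp add: cscale_normalize quantum_fact_def ac_simps power_Suc del: cscale_single)
qed

lemma skew_derivs_ad_power:
  assumes "a \<noteq> b"
  shows "skew_derivs Q (b # replicate m a) (ad_power Q a b m)
    = scalar (ad_coeff Q a b m * quantum_fact (Q a a) m)"
  using skew_derivs_replicate[of Q a 1 1 1 m] assms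
  by (simp add: skew_deriv_ad_power skew_derivs_linear scalar_1 single_mult_single)

text \<open>An element of degree \<open>n a + b + c\<close>, for isotropic degrees that involve all
  three letters.\<close>

definition ad_triple :: "('x \<Rightarrow> 'x \<Rightarrow> complex) \<Rightarrow> 'x \<Rightarrow> 'x \<Rightarrow> 'x \<Rightarrow> nat \<Rightarrow> ('x list \<Rightarrow>\<^sub>0 complex)" where
  "ad_triple Q a b c n = letter c * ad_power Q a b n
     - scalar (Q c a ^ n * Q c b) * (ad_power Q a b n * letter c)"

lemma grading_action_ad_triple:
  "grading_action Q i (ad_triple Q a b c n)
    = scalar (Q i c * (Q i a ^ n * Q i b)) * ad_triple Q a b c n"
  by (simp add: ad_triple_def grading_action_diff grading_action_mult grading_action_ad_power)
    (simp add: cscale_normalize free_vs.scale_right_diff_distrib mult.assoc ac_simps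
      del: cscale_single)

text \<open>For \<open>i = c\<close> the two terms cancel by the choice of the scalar; any other
  \<open>i\<close> kills both \<open>letter c\<close> and the inner commutator.\<close>

lemma skew_deriv_ad_triple_eq_0:
  assumes "a \<noteq> b" "c \<noteq> b" "i \<noteq> b"
  shows "skew_deriv Q i (ad_triple Q a b c n) = 0"
  using assms
  by (simp add: ad_triple_def skew_deriv_diff skew_deriv_mult skew_deriv_letter
      skew_deriv_ad_power grading_action_ad_power)

text \<open>After the derivation by \<open>b\<close> there remain a multiple of
  \<open>c a ^ n\<close> and one of \<open>a ^ n c\<close>; removing \<open>a\<close> and then
  \<open>c\<close> makes them differ by the double braiding of \<open>c\<close> with the degree
  \<open>n a + b\<close>.\<close>

lemma skew_derivs_ad_triple:
  assumes "a \<noteq> b" "a \<noteq> c" "c \<noteq> b"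
  shows "skew_derivs Q (b # replicate n a @ [c]) (ad_triple Q a b c n)
    = scalar (ad_coeff Q a b n * quantum_fact (Q a a) n
        * (1 - (Q c a * Q a c) ^ n * (Q c b * Q b c)))"
proof -
  let ?x = "scalar (ad_coeff Q a b n)" and ?qn = "quantum_fact (Q a a) n"
  have "skew_deriv Q b (ad_triple Q a b c n) = letter c * (?x * letter a ^ n)
      - scalar (Q c a ^ n * Q c b) * (?x * letter a ^ n * (scalar (Q b c) * letter c))"
    using assms by (simp add: ad_triple_def skew_deriv_diff skew_deriv_mult skew_deriv_letter
        skew_deriv_ad_power)
  also have "\<dots> = ?x * (letter c * letter a ^ n * 1)
      - ?x * (scalar (Q c a ^ n * Q c b * Q b c) * (1 * letter a ^ n * letter c))"
    by (simp add: cscale_normalize ac_simps mult.assoc del: cscale_single)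
  finally have *: "skew_deriv Q b (ad_triple Q a b c n) = \<dots>" .
  have "skew_derivs Q (replicate n a) (letter c * letter a ^ n * 1) = scalar ?qn * letter c"
    using skew_derivs_replicate[of Q a "letter c" 1 1 n] assms
    by (simp add: skew_deriv_letter scalar_1)
  moreover have "skew_derivs Q (replicate n a) (1 * letter a ^ n * letter c)
      = scalar (Q a c ^ n * ?qn) * letter c"
    using skew_derivs_replicate[of Q a 1 "letter c" "Q a c" n] assms
    by (simp add: skew_deriv_letter)
  ultimately show ?thesis
    by (simp add: * skew_derivs_linear skew_deriv_diff skew_deriv_scalar_mult skew_deriv_letter
        del: mult_1 mult_1_right)
      (simp add: single_mult_single single_diff[symmetric] algebra_simps power_mult_distrib)
qed


section \<open>Homogeneous tensors\<close>

lemma tensor_power_mult: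
  assumes "f \<in> tensor_power X m" "g \<in> tensor_power X m'"
  shows "f * g \<in> tensor_power X (m + m')"
proof -
  have "w \<in> lists X \<and> length w = m + m'" if "w \<in> Poly_Mapping.keys (f * g)" for w
  proof -
    from that obtain u v where "w = u @ v" "u \<in> Poly_Mapping.keys f" "v \<in> Poly_Mapping.keys g"
      using keys_mult[of f g] by (auto simp: plus_list_def)
    with assms show ?thesis
      by (auto simp: tensor_power_def tensor_algebra_def)
  qed
  then show ?thesis
    by (auto simp: tensor_power_def tensor_algebra_def)
qed

lemma tensor_power_diff:
  assumes "f \<in> tensor_power X m" "g \<in> tensor_power X m"
  shows "f - g \<in> tensor_power X m"
proof -
  have "Poly_Mapping.keys (f - g) \<subseteq> Poly_Mapping.keys f \<union> Poly_Mapping.keys g"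
    by (auto simp: in_keys_iff lookup_minus)
  with assms show ?thesis
    unfolding tensor_power_def tensor_algebra_def by blast
qed

lemma tensor_power_single:
  "w \<in> lists X \<Longrightarrow> Poly_Mapping.single w a \<in> tensor_power X (length w)"
  by (auto simp: tensor_power_def tensor_algebra_def)

lemma tensor_power_letter: "x \<in> X \<Longrightarrow> letter x \<in> tensor_power X (Suc 0)"
  using tensor_power_single[of "[x]" X] by simp

lemma tensor_power_scalar_mult: "f \<in> tensor_power X m \<Longrightarrow> scalar a * f \<in> tensor_power X m"
  using tensor_power_mult[OF tensor_power_single[of "[]"]] by fastforce

lemma tensor_power_power: "f \<in> tensor_power X m \<Longrightarrow> f ^ r \<in> tensor_power X (r * m)"
proof (induction r)
  case 0
  then show ?case using tensor_power_single[of "[]" X 1] by (simp add: scalar_1)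
qed (use tensor_power_mult in fastforce)

lemma tensor_power_ad_power:
  assumes "a \<in> X" "b \<in> X"
  shows "ad_power Q a b m \<in> tensor_power X (Suc m)"
proof (induction m)
  case (Suc m)
  then show ?case
    using tensor_power_mult[OF tensor_power_letter[OF assms(1)] Suc]
      tensor_power_mult[OF Suc tensor_power_letter[OF assms(1)]]
    by (auto intro!: tensor_power_diff tensor_power_scalar_mult)
qed (simp add: tensor_power_letter assms)

lemma tensor_power_ad_triple:
  assumes "a \<in> X" "b \<in> X" "c \<in> X"
  shows "ad_triple Q a b c n \<in> tensor_power X (n + 2)"
  using tensor_power_mult[OF tensor_power_letter[OF assms(3)] tensor_power_ad_power[OF assms(1,2)]]
    tensor_power_mult[OF tensor_power_ad_power[OF assms(1,2)] tensor_power_letter[OF assms(3)]]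
  by (auto simp: ad_triple_def intro!: tensor_power_diff tensor_power_scalar_mult)

section \<open>Inversions and reduced words\<close>

definition inversions :: "nat \<Rightarrow> (nat \<Rightarrow> nat) \<Rightarrow> (nat \<times> nat) set" where
  "inversions m \<sigma> = {(k, l). k < l \<and> l < m \<and> \<sigma> l < \<sigma> k}"

lemma finite_inversions [simp]: "finite (inversions m \<sigma>)"
  by (rule finite_subset[of _ "{..<m} \<times> {..<m}"]) (auto simp: inversions_def)

lemma inversions_id [simp]: "inversions m id = {}"
  by (auto simp: inversions_def)

abbreviation adj :: "nat \<Rightarrow> nat \<Rightarrow> nat" where
  "adj i \<equiv> Transposition.transpose i (Suc i)"

lemma adj_less_iff:
  assumes "x \<noteq> y" "{x, y} \<noteq> {i, Suc i}"
  shows "adj i x < adj i y \<longleftrightarrow> x < y"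
  using assms by (auto simp: Transposition.transpose_def doubleton_eq_iff)

lemma adj_permutes: "Suc i < m \<Longrightarrow> adj i permutes {..<m}"
  by (rule permutes_swap_id) auto

text \<open>Composing with \<open>adj i\<close> on the left exchanges the adjacent values
  \<open>i\<close> and \<open>Suc i\<close> and keeps the order of every other pair of values, so
  just one inversion is gained.\<close>

lemma inversions_adj_less:
  assumes \<sigma>: "\<sigma> permutes {..<m}" and i: "Suc i < m" and less: "inv' \<sigma> i < inv' \<sigma> (Suc i)"
  shows "inversions m (adj i \<circ> \<sigma>) = insert (inv' \<sigma> i, inv' \<sigma> (Suc i)) (inversions m \<sigma>)"
    and "(inv' \<sigma> i, inv' \<sigma> (Suc i)) \<notin> inversions m \<sigma>"
proof -
  let ?p = "inv' \<sigma> i" and ?p' = "inv' \<sigma> (Suc i)"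
  have \<sigma>p: "\<sigma> ?p = i" "\<sigma> ?p' = Suc i"
    using \<sigma> by (simp_all add: permutes_inverses)
  have lt: "?p' < m"
    using permutes_in_image[OF permutes_inv[OF \<sigma>], of "Suc i"] i by auto
  show "(?p, ?p') \<notin> inversions m \<sigma>"
    using \<sigma>p by (auto simp: inversions_def)
  show "inversions m (adj i \<circ> \<sigma>) = insert (?p, ?p') (inversions m \<sigma>)"
  proof (rule Set.set_eqI)
    fix kl :: "nat \<times> nat"
    obtain k l where kl: "kl = (k, l)" by fastforce
    consider "k \<ge> l" | "k = ?p" "l = ?p'" | "k < l" "{\<sigma> l, \<sigma> k} \<noteq> {i, Suc i}"
      using less permutes_inv_eq[OF \<sigma>, of _ k] permutes_inv_eq[OF \<sigma>, of _ l]
      by (metis doubleton_eq_iff leI order.asym)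
    then show "kl \<in> inversions m (adj i \<circ> \<sigma>) \<longleftrightarrow> kl \<in> insert (?p, ?p') (inversions m \<sigma>)"
    proof cases
      case 1
      with less show ?thesis by (auto simp: kl inversions_def)
    next
      case 2
      with \<sigma>p less lt show ?thesis by (auto simp: kl inversions_def)
    next
      case 3
      then have "\<sigma> l \<noteq> \<sigma> k"
        using inj_eq[OF permutes_inj[OF \<sigma>]] by simp
      with 3 have "adj i (\<sigma> l) < adj i (\<sigma> k) \<longleftrightarrow> \<sigma> l < \<sigma> k"
        by (intro adj_less_iff) auto
      with 3 \<sigma>p show ?thesis by (auto simp: kl inversions_def)
    qed
  qed
qed

lemma inversions_adj_greater:
  assumes \<sigma>: "\<sigma> permutes {..<m}" and i: "Suc i < m" and gr: "inv' \<sigma> (Suc i) < inv' \<sigma> i"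
  shows "card (inversions m \<sigma>) = Suc (card (inversions m (adj i \<circ> \<sigma>)))"
proof -
  let ?\<tau> = "adj i \<circ> \<sigma>"
  have \<tau>: "?\<tau> permutes {..<m}"
    using permutes_compose[OF \<sigma> adj_permutes[OF i]] .
  have "inv' ?\<tau> = inv' \<sigma> \<circ> adj i"
    using permutes_bij[OF \<sigma>] by (simp add: o_inv_distrib)
  then have "inv' ?\<tau> i < inv' ?\<tau> (Suc i)"
    using gr by simp
  from inversions_adj_less[OF \<tau> i this] have "card (inversions m (adj i \<circ> ?\<tau>)) =
      Suc (card (inversions m ?\<tau>))"
    by simp
  moreover have "adj i \<circ> ?\<tau> = \<sigma>"
    by (simp add: fun_eq_iff)
  ultimately show ?thesis by simp
qed

lemma perm_of_word_simps:
  "perm_of_word [] = id" "perm_of_word (i # is) = adj i \<circ> perm_of_word is"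
  by (simp_all add: perm_of_word_def)

lemma perm_of_word_permutes:
  "\<forall>i\<in>set is. Suc i < m \<Longrightarrow> perm_of_word is permutes {..<m}"
proof (induction "is")
  case (Cons i "is")
  then show ?case
    using permutes_compose[of "perm_of_word is" "{..<m}" "adj i"] adj_permutes[of i m]
    by (simp add: perm_of_word_simps comp_def)
qed (simp add: perm_of_word_simps permutes_id)

lemma inv_adjacent_neq:
  assumes "\<sigma> permutes {..<m}"
  shows "inv' \<sigma> i \<noteq> inv' \<sigma> (Suc i)"
  using permutes_inj[OF permutes_inv[OF assms]] by (simp add: inj_eq)

lemma card_inversions_le_length:
  "\<forall>i\<in>set is. Suc i < m \<Longrightarrow> card (inversions m (perm_of_word is)) \<le> length is"
proof (induction "is")
  case Nil
  then show ?case using inversions_id[of m] by (simp add: perm_of_word_simps id_def)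
next
  case (Cons i "is")
  let ?\<sigma> = "perm_of_word is"
  have \<sigma>: "?\<sigma> permutes {..<m}" and i: "Suc i < m"
    using Cons.prems by (auto intro: perm_of_word_permutes)
  have "card (inversions m (adj i \<circ> ?\<sigma>)) \<le> length (i # is)"
    using Cons inversions_adj_less[OF \<sigma> i] inversions_adj_greater[OF \<sigma> i] inv_adjacent_neq[OF \<sigma>]
    by (cases "inv' ?\<sigma> i < inv' ?\<sigma> (Suc i)") (auto simp: not_less nat_less_le)
  then show ?case by (simp add: perm_of_word_simps comp_def)
qed

lemma permutes_no_descent_imp_id:
  assumes \<sigma>: "\<sigma> permutes {..<m}" and "\<And>i. Suc i < m \<Longrightarrow> \<sigma> i < \<sigma> (Suc i)"
  shows "\<sigma> = id"
proof (rule permutes_natset_ge[OF \<sigma>], rule ballI)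
  have "i < m \<Longrightarrow> i \<le> \<sigma> i" for i
  proof (induction i)
    case (Suc i)
    then show ?case using assms(2)[of i] by auto
  qed simp
  then show "i \<in> {..<m} \<Longrightarrow> i \<le> \<sigma> i" for i by auto
qed

text \<open>Bubble sort: undoing a descent of the inverse removes one inversion, and a permutation
  whose inverse has no descent is the identity.\<close>

lemma ex_word_length_inversions:
  assumes "\<sigma> permutes {..<m}"
  shows "\<exists>is. (\<forall>i\<in>set is. Suc i < m) \<and> perm_of_word is = \<sigma> \<and> length is = card (inversions m \<sigma>)"
  using assms
proof (induction "card (inversions m \<sigma>)" arbitrary: \<sigma> rule: less_induct)
  case less
  show ?case
  proof (cases "\<exists>i. Suc i < m \<and> inv' \<sigma> (Suc i) < inv' \<sigma> i")
    case True
    then obtain i where i: "Suc i < m" and gr: "inv' \<sigma> (Suc i) < inv' \<sigma> i" by blast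
    note card = inversions_adj_greater[OF less.prems i gr]
    have "adj i \<circ> \<sigma> permutes {..<m}"
      using permutes_compose[OF less.prems adj_permutes[OF i]] .
    with less.hyps[of "adj i \<circ> \<sigma>"] card obtain "is" where "\<forall>i\<in>set is. Suc i < m"
        "perm_of_word is = adj i \<circ> \<sigma>" "length is = card (inversions m (adj i \<circ> \<sigma>))"
      by auto
    with i card show ?thesis
      by (intro exI[of _ "i # is"]) (auto simp: perm_of_word_simps fun_eq_iff)
  next
    case False
    then have "inv' \<sigma> i < inv' \<sigma> (Suc i)" if "Suc i < m" for i
      using inv_adjacent_neq[OF less.prems, of i] that by (meson linorder_neqE_nat)
    then have "inv' \<sigma> = id"
      using permutes_no_descent_imp_id[OF permutes_inv[OF less.prems]] by blast
    then have "\<sigma> = id"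
      using permutes_inv_inv[OF less.prems] by simp
    show ?thesis
      unfolding \<open>\<sigma> = id\<close> by (intro exI[of _ "[]"]) (unfold perm_of_word_simps, simp)
  qed
qed

text \<open>What the computation of \<open>matsumoto_lift\<close> uses of the word chosen there; in
  particular its length is the number of inversions.\<close>

lemma reduced_word_some:
  assumes "\<sigma> permutes {..<m}"
  defines "is \<equiv> SOME is. reduced_word m \<sigma> is"
  shows "\<forall>i\<in>set is. Suc i < m" "perm_of_word is = \<sigma>" "length is = card (inversions m \<sigma>)"
proof -
  from ex_word_length_inversions[OF assms(1)] obtain js where
    js: "\<forall>i\<in>set js. Suc i < m" "perm_of_word js = \<sigma>" "length js = card (inversions m \<sigma>)"
    by blast
  then have "reduced_word m \<sigma> js"
    using card_inversions_le_length unfolding reduced_word_def by metis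
  then have red: "reduced_word m \<sigma> is"
    unfolding is_def by (rule someI)
  then show *: "\<forall>i\<in>set is. Suc i < m" "perm_of_word is = \<sigma>"
    by (auto simp: reduced_word_def)
  have "length is \<le> length js"
    using red js unfolding reduced_word_def by blast
  with js card_inversions_le_length[OF *(1)] * show "length is = card (inversions m \<sigma>)"
    by simp
qed


section \<open>The quantum symmetrizer of a diagonal braiding\<close>

text \<open>Each inversion is one crossing of the braid that lifts the permutation.\<close>

definition inversion_weight :: "('x \<Rightarrow> 'x \<Rightarrow> complex) \<Rightarrow> 'x list \<Rightarrow> (nat \<Rightarrow> nat) \<Rightarrow> complex" where
  "inversion_weight Q w \<sigma> = (\<Prod>(k, l)\<in>inversions (length w) \<sigma>. Q (w ! k) (w ! l))"

text \<open>Relative to a subset of the basis, since the braiding of the whole Yetter-Drinfeld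
  module need not be diagonal.\<close>

definition diagonal_on :: "'x set \<Rightarrow> 'x braiding \<Rightarrow> ('x \<Rightarrow> 'x \<Rightarrow> complex) \<Rightarrow> bool" where
  "diagonal_on Y c Q \<longleftrightarrow> (\<forall>x\<in>Y. \<forall>y\<in>Y. c x y = Poly_Mapping.single (y, x) (Q x y))"

lemma braid_at_diagonal:
  assumes "diagonal_on Y c Q" "w \<in> lists Y" "Suc i < length w"
  shows "braid_at c i (Poly_Mapping.single w a)
    = Poly_Mapping.single (w[i := w ! Suc i, Suc i := w ! i]) (a * Q (w ! i) (w ! Suc i))"
proof -
  have "w ! i \<in> Y" "w ! Suc i \<in> Y"
    using assms by (auto simp: lists_eq_set subset_iff)
  with assms show ?thesis
    by (simp add: braid_at_def diagonal_on_def)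
qed

text \<open>In a word as short as the number of inversions every letter adds an inversion, so each
  inverted pair is braided once and in its original order. The letter at position \<open>k\<close>
  moves to the image of \<open>k\<close>, whence the inverse in \<open>permute_list\<close>.\<close>

lemma word_lift_diagonal:
  assumes c: "diagonal_on Y c Q" and w: "w \<in> lists Y"
    and "\<forall>i\<in>set is. Suc i < length w" "length is = card (inversions (length w) (perm_of_word is))"
  shows "foldr (\<lambda>i h. braid_at c i \<circ> h) is id (Poly_Mapping.single w a)
    = Poly_Mapping.single (permute_list (inv' (perm_of_word is)) w)
        (a * inversion_weight Q w (perm_of_word is))"
  using assms(3,4)
proof (induction "is")
  case Nil
  then show ?case unfolding perm_of_word_simps by (simp add: inversion_weight_def)
next
  case (Cons i "is")
  have prems: "\<forall>i\<in>set (i # is). Suc i < length w"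
      "length (i # is) = card (inversions (length w) (adj i \<circ> perm_of_word is))"
    using Cons.prems by (simp_all add: perm_of_word_simps comp_def)
  let ?\<sigma> = "perm_of_word is" and ?m = "length w"
  have \<sigma>: "?\<sigma> permutes {..<?m}" and i: "Suc i < ?m"
    using Cons.prems by (auto intro: perm_of_word_permutes)
  have le: "card (inversions ?m ?\<sigma>) \<le> length is"
    using Cons.prems by (intro card_inversions_le_length) auto
  \<comment> \<open>Otherwise prefixing \<open>i\<close> would lower the number of inversions, which
    could then not equal the length of the longer word.\<close>
  have less: "inv' ?\<sigma> i < inv' ?\<sigma> (Suc i)"
  proof (rule ccontr)
    assume "\<not> ?thesis"
    then have "inv' ?\<sigma> (Suc i) < inv' ?\<sigma> i"
      using inv_adjacent_neq[OF \<sigma>, of i] by linarith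
    with inversions_adj_greater[OF \<sigma> i] prems(2) le show False
      by simp
  qed
  note inversions = inversions_adj_less[OF \<sigma> i less]
  have len: "length is = card (inversions ?m ?\<sigma>)"
    using prems(2) inversions by simp
  let ?v = "permute_list (inv' ?\<sigma>) w"
  have inv\<sigma>: "inv' ?\<sigma> permutes {..<?m}"
    by (rule permutes_inv[OF \<sigma>])
  have nth: "?v ! k = w ! (inv' ?\<sigma> k)" if "k < ?m" for k
    using permute_list_nth[OF inv\<sigma> that] .
  have v: "?v \<in> lists Y"
    using w set_permute_list[OF inv\<sigma>] by (auto simp: lists_eq_set)
  have "?v[i := ?v ! Suc i, Suc i := ?v ! i] = permute_list (inv' ?\<sigma> \<circ> adj i) w"
  proof (rule nth_equalityI)
    fix k
    assume "k < length (?v[i := ?v ! Suc i, Suc i := ?v ! i])"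
    then have k: "k < ?m" by simp
    have "permute_list (inv' ?\<sigma> \<circ> adj i) w ! k = w ! inv' ?\<sigma> (adj i k)"
      using permute_list_nth[OF permutes_compose[OF adj_permutes[OF i] inv\<sigma>] k] by simp
    with k i show "?v[i := ?v ! Suc i, Suc i := ?v ! i] ! k = permute_list (inv' ?\<sigma> \<circ> adj i) w ! k"
      by (auto simp: nth nth_list_update Transposition.transpose_def)
  qed simp
  moreover have "inv' (adj i \<circ> ?\<sigma>) = inv' ?\<sigma> \<circ> adj i"
    using permutes_bij[OF \<sigma>] by (simp add: o_inv_distrib)
  moreover have "inversion_weight Q w (adj i \<circ> ?\<sigma>) = inversion_weight Q w ?\<sigma> * Q (?v ! i) (?v ! Suc i)"
    using i inversions by (simp add: inversion_weight_def nth)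
  moreover have "foldr (\<lambda>i h. braid_at c i \<circ> h) is id (Poly_Mapping.single w a)
      = Poly_Mapping.single ?v (a * inversion_weight Q w ?\<sigma>)"
    using Cons.IH prems(1) len by (simp add: comp_def id_def)
  ultimately have "foldr (\<lambda>i h. braid_at c i \<circ> h) (i # is) id (Poly_Mapping.single w a)
      = Poly_Mapping.single (permute_list (inv' (adj i \<circ> ?\<sigma>)) w)
          (a * inversion_weight Q w (adj i \<circ> ?\<sigma>))"
    using braid_at_diagonal[OF c v, of i] i by (simp add: mult.assoc)
  then show ?case by (simp add: perm_of_word_simps comp_def id_def)
qed

lemma matsumoto_lift_diagonal:
  assumes "diagonal_on Y c Q" "w \<in> lists Y" "\<sigma> permutes {..<length w}"
  shows "matsumoto_lift c (length w) \<sigma> (Poly_Mapping.single w a)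
    = Poly_Mapping.single (permute_list (inv' \<sigma>) w) (a * inversion_weight Q w \<sigma>)"
  using word_lift_diagonal[OF assms(1,2), of "SOME is. reduced_word (length w) \<sigma> is"]
    reduced_word_some[OF assms(3)]
  by (simp add: matsumoto_lift_def)


text \<open>\<open>to_last p m\<close> moves \<open>p\<close> to \<open>m\<close> and \<open>from_last p m\<close> is its inverse; every permutation of
  \<open>{..m}\<close> is uniquely a permutation of \<open>{..<m}\<close> after some \<open>to_last p m\<close>.\<close>

definition to_last :: "nat \<Rightarrow> nat \<Rightarrow> nat \<Rightarrow> nat" where
  "to_last p m k = (if k = p then m else if p < k \<and> k \<le> m then k - 1 else k)"

definition from_last :: "nat \<Rightarrow> nat \<Rightarrow> nat \<Rightarrow> nat" where
  "from_last p m k = (if k = m then p else if p \<le> k \<and> k < m then Suc k else k)"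

lemma from_last_to_last: "p \<le> m \<Longrightarrow> from_last p m (to_last p m k) = k"
  and to_last_from_last: "p \<le> m \<Longrightarrow> to_last p m (from_last p m k) = k"
  by (auto simp: from_last_def to_last_def)

lemma to_last_permutes: "p \<le> m \<Longrightarrow> to_last p m permutes {..<Suc m}"
  by (rule bij_imp_permutes[OF bij_betw_byWitness[where f' = "from_last p m"]])
    (auto simp: from_last_to_last to_last_from_last, auto simp: from_last_def to_last_def)

lemma inv_to_last: "p \<le> m \<Longrightarrow> inv' (to_last p m) = from_last p m"
  by (rule inv_unique_comp) (auto simp: fun_eq_iff from_last_to_last to_last_from_last)

text \<open>Here \<open>p\<close> is the position sent to \<open>m\<close>, hence recovered from
  \<open>\<sigma>\<close> as \<open>inv' \<sigma> m\<close>.\<close>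

lemma sum_permutes_Suc:
  "(\<Sum>\<sigma> | \<sigma> permutes {..<Suc m}. F \<sigma>) = (\<Sum>p\<le>m. \<Sum>\<tau> | \<tau> permutes {..<m}. F (\<tau> \<circ> to_last p m))"
proof -
  have \<tau>: "\<tau> permutes {..<Suc m}" if "\<tau> permutes {..<m}" for \<tau>
    using that by (rule permutes_subset) auto
  have "(\<Sum>p\<le>m. \<Sum>\<tau> | \<tau> permutes {..<m}. F (\<tau> \<circ> to_last p m))
      = (\<Sum>(p, \<tau>)\<in>{..m} \<times> {\<tau>. \<tau> permutes {..<m}}. F (\<tau> \<circ> to_last p m))"
    by (simp add: sum.cartesian_product)
  also have "\<dots> = (\<Sum>\<sigma> | \<sigma> permutes {..<Suc m}. F \<sigma>)"
  proof (rule sum.reindex_bij_witness[where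
        j = "\<lambda>(p, \<tau>). \<tau> \<circ> to_last p m" and i = "\<lambda>\<sigma>. (inv' \<sigma> m, \<sigma> \<circ> from_last (inv' \<sigma> m) m)"])
    fix p\<tau> :: "nat \<times> (nat \<Rightarrow> nat)"
    assume "p\<tau> \<in> {..m} \<times> {\<tau>. \<tau> permutes {..<m}}"
    then obtain p \<tau>' where p\<tau>: "p\<tau> = (p, \<tau>')" "p \<le> m" "\<tau>' permutes {..<m}"
      by auto
    have perm: "\<tau>' \<circ> to_last p m permutes {..<Suc m}"
      using permutes_compose[OF to_last_permutes[OF p\<tau>(2)] \<tau>[OF p\<tau>(3)]] .
    have "(\<tau>' \<circ> to_last p m) p = m"
      using permutes_not_in[OF p\<tau>(3), of m] by (simp add: to_last_def)
    then have "inv' (\<tau>' \<circ> to_last p m) m = p"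
      using permutes_inv_eq[OF perm] by blast
    moreover have "\<tau>' \<circ> to_last p m \<circ> from_last p m = \<tau>'"
      using p\<tau>(2) by (simp add: fun_eq_iff to_last_from_last)
    ultimately show "(\<lambda>\<sigma>. (inv' \<sigma> m, \<sigma> \<circ> from_last (inv' \<sigma> m) m))
        (case p\<tau> of (p, \<tau>) \<Rightarrow> \<tau> \<circ> to_last p m) = p\<tau>"
      by (simp add: p\<tau>)
    show "(case p\<tau> of (p, \<tau>) \<Rightarrow> \<tau> \<circ> to_last p m) \<in> {\<sigma>. \<sigma> permutes {..<Suc m}}"
      using perm by (simp add: p\<tau>)
    show "F (case p\<tau> of (p, \<tau>) \<Rightarrow> \<tau> \<circ> to_last p m) = (case p\<tau> of (p, \<tau>) \<Rightarrow> F (\<tau> \<circ> to_last p m))"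
      by (simp add: p\<tau>)
  next
    fix \<sigma> :: "nat \<Rightarrow> nat"
    assume "\<sigma> \<in> {\<sigma>. \<sigma> permutes {..<Suc m}}"
    then have \<sigma>: "\<sigma> permutes {..<Suc m}" by simp
    let ?p = "inv' \<sigma> m"
    have p: "?p \<le> m"
      using permutes_in_image[OF permutes_inv[OF \<sigma>], of m] by auto
    show "(case (?p, \<sigma> \<circ> from_last ?p m) of (p, \<tau>) \<Rightarrow> \<tau> \<circ> to_last p m) = \<sigma>"
      using p by (simp add: fun_eq_iff from_last_to_last)
    have "\<sigma> \<circ> from_last ?p m permutes {..<Suc m}"
      using permutes_compose[OF permutes_inv[OF to_last_permutes[OF p]] \<sigma>] inv_to_last[OF p] by simp
    moreover have "(\<sigma> \<circ> from_last ?p m) m = m"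
      using permutes_inverses(1)[OF \<sigma>] by (simp add: from_last_def)
    ultimately have "\<sigma> \<circ> from_last ?p m permutes {..<m}"
      by (elim permutes_superset) (auto simp: less_Suc_eq)
    with p show "(?p, \<sigma> \<circ> from_last ?p m) \<in> {..m} \<times> {\<tau>. \<tau> permutes {..<m}}"
      by simp
  qed
  finally show ?thesis ..
qed

definition drop_nth :: "nat \<Rightarrow> 'x list \<Rightarrow> 'x list" where
  "drop_nth p w = take p w @ drop (Suc p) w"

lemma length_drop_nth: "p < length w \<Longrightarrow> length (drop_nth p w) = length w - 1"
  by (simp add: drop_nth_def)

lemma nth_drop_nth:
  "p \<le> m \<Longrightarrow> length w = Suc m \<Longrightarrow> k < m \<Longrightarrow> drop_nth p w ! k = w ! from_last p m k"
  by (auto simp: drop_nth_def nth_append from_last_def min_def)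

lemma permute_list_to_last:
  assumes w: "length w = Suc m" and p: "p \<le> m" and \<tau>: "\<tau> permutes {..<m}"
  shows "permute_list (inv' (\<tau> \<circ> to_last p m)) w = permute_list (inv' \<tau>) (drop_nth p w) @ [w ! p]"
proof (rule nth_equalityI)
  have \<tau>': "\<tau> permutes {..<Suc m}"
    using \<tau> by (rule permutes_subset) auto
  have inv: "inv' (\<tau> \<circ> to_last p m) = from_last p m \<circ> inv' \<tau>"
    using permutes_bij[OF \<tau>] permutes_bij[OF to_last_permutes[OF p]] p
    by (simp add: o_inv_distrib inv_to_last)
  have perm: "inv' (\<tau> \<circ> to_last p m) permutes {..<length w}"
    using permutes_inv[OF permutes_compose[OF to_last_permutes[OF p] \<tau>']] w by simp
  have len: "length (drop_nth p w) = m"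
    using w p by (simp add: length_drop_nth)
  then show "length (permute_list (inv' (\<tau> \<circ> to_last p m)) w)
      = length (permute_list (inv' \<tau>) (drop_nth p w) @ [w ! p])"
    using w by simp
  fix j
  assume "j < length (permute_list (inv' (\<tau> \<circ> to_last p m)) w)"
  then have j: "j < Suc m" using w by simp
  have L: "permute_list (inv' (\<tau> \<circ> to_last p m)) w ! j = w ! from_last p m (inv' \<tau> j)"
    using permute_list_nth[OF perm] j w by (simp add: inv)
  show "permute_list (inv' (\<tau> \<circ> to_last p m)) w ! j
      = (permute_list (inv' \<tau>) (drop_nth p w) @ [w ! p]) ! j"
  proof (cases "j = m")
    case True
    have "inv' \<tau> m = m"
      using permutes_not_in[OF permutes_inv[OF \<tau>], of m] by simp
    with True show ?thesis
      unfolding L by (simp add: nth_append len from_last_def)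
  next
    case False
    then have "j < m" "inv' \<tau> j < m"
      using j permutes_in_image[OF permutes_inv[OF \<tau>], of j] by auto
    then show ?thesis
      unfolding L using permutes_inv[OF \<tau>] len
      by (simp add: nth_append permute_list_nth nth_drop_nth[OF p w])
  qed
qed

text \<open>Position \<open>p\<close> overtakes all later positions, which gives the first set; the
  other inversions are those of \<open>\<tau>\<close>, relabelled by the increasing map that skips
  \<open>p\<close>.\<close>

lemma inversions_to_last:
  assumes p: "p \<le> m" and \<tau>: "\<tau> permutes {..<m}"
  shows "inversions (Suc m) (\<tau> \<circ> to_last p m) = {p} \<times> {p<..m}
    \<union> map_prod (from_last p m) (from_last p m) ` inversions m \<tau>"
proof (rule Set.set_eqI)
  fix kl :: "nat \<times> nat"
  obtain k l where kl: "kl = (k, l)" by fastforce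
  have \<tau>m: "\<tau> m = m" and \<tau>l: "\<And>j. j < m \<Longrightarrow> \<tau> j < m"
    using permutes_not_in[OF \<tau>, of m] permutes_in_image[OF \<tau>] by auto
  have image: "(k, l) \<in> map_prod (from_last p m) (from_last p m) ` inversions m \<tau> \<longleftrightarrow>
      (to_last p m k, to_last p m l) \<in> inversions m \<tau>"
    by (force simp: from_last_to_last[OF p] to_last_from_last[OF p] image_iff)
  consider "k = p" | "k \<noteq> p" "l = p" | "k \<noteq> p" "l \<noteq> p" by blast
  then show "kl \<in> inversions (Suc m) (\<tau> \<circ> to_last p m) \<longleftrightarrow> kl \<in> {p} \<times> {p<..m}
      \<union> map_prod (from_last p m) (from_last p m) ` inversions m \<tau>"
    unfolding kl Un_iff image
  proof cases
    case 1
    then show "(k, l) \<in> inversions (Suc m) (\<tau> \<circ> to_last p m) \<longleftrightarrow> (k, l) \<in> {p} \<times> {p<..m}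
        \<or> (to_last p m k, to_last p m l) \<in> inversions m \<tau>"
      using p by (auto simp: inversions_def to_last_def \<tau>m intro: \<tau>l)
  next
    case 2
    then show "(k, l) \<in> inversions (Suc m) (\<tau> \<circ> to_last p m) \<longleftrightarrow> (k, l) \<in> {p} \<times> {p<..m}
        \<or> (to_last p m k, to_last p m l) \<in> inversions m \<tau>"
      using p \<tau>l[of k] by (auto simp: inversions_def to_last_def \<tau>m)
  next
    case 3
    then show "(k, l) \<in> inversions (Suc m) (\<tau> \<circ> to_last p m) \<longleftrightarrow> (k, l) \<in> {p} \<times> {p<..m}
        \<or> (to_last p m k, to_last p m l) \<in> inversions m \<tau>"
      using p by (auto simp: inversions_def to_last_def)
  qed
qed

text \<open>The first factor is the coefficient with which a skew derivation deletes position
  \<open>p\<close>.\<close>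

lemma inversion_weight_to_last:
  assumes w: "length w = Suc m" and p: "p \<le> m" and \<tau>: "\<tau> permutes {..<m}"
  shows "inversion_weight Q w (\<tau> \<circ> to_last p m)
    = word_char Q (w ! p) (drop (Suc p) w) * inversion_weight Q (drop_nth p w) \<tau>"
proof -
  let ?f = "map_prod (from_last p m) (from_last p m)" and ?h = "\<lambda>(k, l). Q (w ! k) (w ! l)"
  have len: "length (drop_nth p w) = m"
    using w p by (simp add: length_drop_nth)
  have inj: "inj (from_last p m)"
    by (rule inj_on_inverseI[of _ "to_last p m"]) (simp add: to_last_from_last[OF p])
  have "from_last p m k \<noteq> p" if "k < m" for k
    using that p by (auto simp: from_last_def)
  then have disj: "({p} \<times> {p<..m}) \<inter> ?f ` inversions m \<tau> = {}"
    by (auto simp: inversions_def) (metis less_trans)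
  have "inversion_weight Q w (\<tau> \<circ> to_last p m)
      = prod ?h ({p} \<times> {p<..m}) * prod ?h (?f ` inversions m \<tau>)"
    unfolding inversion_weight_def w inversions_to_last[OF p \<tau>]
    by (rule prod.union_disjoint) (use disj in auto)
  also have "prod ?h (?f ` inversions m \<tau>) = inversion_weight Q (drop_nth p w) \<tau>"
    unfolding inversion_weight_def len
    by (subst prod.reindex)
      (auto intro!: prod.cong simp: inversions_def nth_drop_nth[OF p w]
        inj_on_subset[OF prod.inj_map[OF inj inj]])
  also have "prod ?h ({p} \<times> {p<..m}) = (\<Prod>l\<in>{p<..m}. Q (w ! p) (w ! l))"
    by (simp add: prod.cartesian_product[symmetric])
  also have "\<dots> = word_char Q (w ! p) (drop (Suc p) w)"
  proof -
    have "word_char Q (w ! p) (drop (Suc p) w)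
        = (\<Prod>k<m - p. Q (w ! p) (w ! (Suc p + k)))"
      using w p by (auto simp: word_char_def prod.list_conv_set_nth atLeast0LessThan intro!: prod.cong)
    also have "\<dots> = (\<Prod>l\<in>{p<..m}. Q (w ! p) (w ! l))"
      by (rule prod.reindex_bij_witness[where i = "\<lambda>l. l - Suc p" and j = "\<lambda>k. Suc p + k"])
        (use p in auto)
    finally show ?thesis ..
  qed
  finally show ?thesis .
qed

section \<open>Linearity of the braid lifts and of the quantum symmetrizer\<close>

lemma matsumoto_lift_add:
  "matsumoto_lift c m \<sigma> (f + g) = matsumoto_lift c m \<sigma> f + matsumoto_lift c m \<sigma> g"
  and matsumoto_lift_cscale:
  "matsumoto_lift c m \<sigma> (cscale a f) = cscale a (matsumoto_lift c m \<sigma> f)"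
proof -
  have "foldr (\<lambda>i h. braid_at c i \<circ> h) is id (f + g)
      = foldr (\<lambda>i h. braid_at c i \<circ> h) is id f + foldr (\<lambda>i h. braid_at c i \<circ> h) is id g"
    and "foldr (\<lambda>i h. braid_at c i \<circ> h) is id (cscale a f)
      = cscale a (foldr (\<lambda>i h. braid_at c i \<circ> h) is id f)" for "is"
    by (induction "is") (auto simp: braid_at_def lin_ext_add lin_ext_cscale)
  then show "matsumoto_lift c m \<sigma> (f + g) = matsumoto_lift c m \<sigma> f + matsumoto_lift c m \<sigma> g"
    and "matsumoto_lift c m \<sigma> (cscale a f) = cscale a (matsumoto_lift c m \<sigma> f)"
    by (auto simp: matsumoto_lift_def)
qed

lemma quantum_symmetrizer_add:
  "quantum_symmetrizer c m (f + g) = quantum_symmetrizer c m f + quantum_symmetrizer c m g"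
  by (simp add: quantum_symmetrizer_def matsumoto_lift_add sum.distrib)

lemma quantum_symmetrizer_cscale:
  "quantum_symmetrizer c m (cscale a f) = cscale a (quantum_symmetrizer c m f)"
  by (simp add: quantum_symmetrizer_def matsumoto_lift_cscale free_vs.scale_sum_right)

lemma quantum_symmetrizer_0 [simp]: "quantum_symmetrizer c m 0 = 0"
  using quantum_symmetrizer_cscale[of c m 0 0] by simp

lemma quantum_symmetrizer_sum:
  "quantum_symmetrizer c m (sum F A) = (\<Sum>a\<in>A. quantum_symmetrizer c m (F a))"
  by (induction A rule: infinite_finite_induct) (auto simp: quantum_symmetrizer_add)

lemma quantum_symmetrizer_diagonal:
  assumes "diagonal_on Y c Q" "w \<in> lists Y" "length w = m"
  shows "quantum_symmetrizer c m (Poly_Mapping.single w a) = (\<Sum>\<sigma> | \<sigma> permutes {..<m}.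
    Poly_Mapping.single (permute_list (inv' \<sigma>) w) (a * inversion_weight Q w \<sigma>))"
  using assms(3) matsumoto_lift_diagonal[OF assms(1,2)]
  by (auto simp: quantum_symmetrizer_def intro!: sum.cong)

section \<open>Skew derivations as coefficients of the quantum symmetrizer\<close>

definition last_coeff :: "'x \<Rightarrow> ('x list \<Rightarrow>\<^sub>0 complex) \<Rightarrow> ('x list \<Rightarrow>\<^sub>0 complex)" where
  "last_coeff i = lin_ext (\<lambda>u. if u \<noteq> [] \<and> last u = i then Poly_Mapping.single (butlast u) 1 else 0)"

lemma skew_deriv_word_eq_sum:
  "skew_deriv_word Q i w = (\<Sum>p<length w. if w ! p = i
     then Poly_Mapping.single (drop_nth p w) (word_char Q i (drop (Suc p) w)) else 0)"
proof (induction w)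
  case (Cons x w)
  let ?F = "\<lambda>w p. if w ! p = i
     then Poly_Mapping.single (drop_nth p w) (word_char Q i (drop (Suc p) w)) else 0"
  have "letter x * (\<Sum>p<length w. ?F w p) = (\<Sum>p<length w. ?F (x # w) (Suc p))"
    unfolding sum_distrib_left
    by (intro sum.cong) (auto simp: drop_nth_def single_mult_single)
  then have "skew_deriv_word Q i (x # w) = ?F (x # w) 0 + (\<Sum>p<length w. ?F (x # w) (Suc p))"
    using Cons by (simp add: drop_nth_def)
  then show ?case
    by (simp only: sum.lessThan_Suc_shift list.size add_Suc_right add_0_right)
qed simp

lemma drop_nth_in_lists: "w \<in> lists Y \<Longrightarrow> drop_nth p w \<in> lists Y"
  by (auto simp: drop_nth_def lists_eq_set dest: in_set_takeD in_set_dropD)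

text \<open>Grouping the permutations by the position \<open>p\<close> that ends last splits off the
  last letter; what remains is the symmetrizer one degree lower, weighted as in
  \<open>skew_deriv_word_eq_sum\<close>.\<close>

lemma last_coeff_quantum_symmetrizer_single:
  assumes c: "diagonal_on Y c Q" and w: "w \<in> lists Y" "length w = Suc m"
  shows "last_coeff i (quantum_symmetrizer c (Suc m) (Poly_Mapping.single w a))
    = quantum_symmetrizer c m (skew_deriv Q i (Poly_Mapping.single w a))"
proof -
  have len: "length (drop_nth p w) = m" if "p \<le> m" for p
    using that w by (simp add: length_drop_nth)
  have "last_coeff i (quantum_symmetrizer c (Suc m) (Poly_Mapping.single w a))
      = (\<Sum>p\<le>m. \<Sum>\<tau> | \<tau> permutes {..<m}. last_coeff i
          (Poly_Mapping.single (permute_list (inv' (\<tau> \<circ> to_last p m)) w)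
            (a * inversion_weight Q w (\<tau> \<circ> to_last p m))))"
    unfolding quantum_symmetrizer_diagonal[OF c w] last_coeff_def lin_ext_sum
    by (rule sum_permutes_Suc)
  also have "\<dots> = (\<Sum>p\<le>m. \<Sum>\<tau> | \<tau> permutes {..<m}. if w ! p = i
      then Poly_Mapping.single (permute_list (inv' \<tau>) (drop_nth p w))
        (a * (word_char Q i (drop (Suc p) w) * inversion_weight Q (drop_nth p w) \<tau>)) else 0)"
    using w by (intro sum.cong)
      (auto simp: last_coeff_def permute_list_to_last inversion_weight_to_last simp del: o_apply)
  also have "\<dots> = (\<Sum>p\<le>m. if w ! p = i then quantum_symmetrizer c m
      (Poly_Mapping.single (drop_nth p w) (a * word_char Q i (drop (Suc p) w))) else 0)"
    by (intro sum.cong)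
      (auto simp: quantum_symmetrizer_diagonal[OF c drop_nth_in_lists[OF w(1)] len] mult.assoc)
  also have "\<dots> = quantum_symmetrizer c m (skew_deriv Q i (Poly_Mapping.single w a))"
    unfolding skew_deriv_def lin_ext_single skew_deriv_word_eq_sum w(2) lessThan_Suc_atMost
      free_vs.scale_sum_right quantum_symmetrizer_sum
    by (intro sum.cong) (auto simp: if_distrib)
  finally show ?thesis .
qed

lemma last_coeff_quantum_symmetrizer:
  assumes "diagonal_on Y c Q" and f: "f \<in> tensor_power Y (Suc m)"
  shows "last_coeff i (quantum_symmetrizer c (Suc m) f) = quantum_symmetrizer c m (skew_deriv Q i f)"
proof -
  have "last_coeff i (quantum_symmetrizer c (Suc m) (Poly_Mapping.single w (Poly_Mapping.lookup f w)))
      = quantum_symmetrizer c m (skew_deriv Q i (Poly_Mapping.single w (Poly_Mapping.lookup f w)))"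
    if "w \<in> Poly_Mapping.keys f" for w
    using that f
    by (intro last_coeff_quantum_symmetrizer_single[OF assms(1)])
      (auto simp: tensor_power_def tensor_algebra_def)
  then show ?thesis
    by (subst (1 2) poly_mapping_eq_sum_single)
      (simp add: quantum_symmetrizer_sum skew_deriv_sum last_coeff_def lin_ext_sum)
qed

lemma tensor_power_0: "0 \<in> tensor_power Y m"
  by (simp add: tensor_power_def tensor_algebra_def)

lemma tensor_power_sum:
  assumes "\<And>a. a \<in> A \<Longrightarrow> F a \<in> tensor_power Y m"
  shows "sum F A \<in> tensor_power Y m"
proof -
  have "Poly_Mapping.keys (sum F A) \<subseteq> (\<Union>a\<in>A. Poly_Mapping.keys (F a))"
  proof
    fix w
    assume "w \<in> Poly_Mapping.keys (sum F A)"
    then have "(\<Sum>a\<in>A. Poly_Mapping.lookup (F a) w) \<noteq> 0"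
      by (simp add: in_keys_iff lookup_sum)
    then obtain a where "a \<in> A" "Poly_Mapping.lookup (F a) w \<noteq> 0"
      by (rule sum.not_neutral_contains_not_neutral)
    then show "w \<in> (\<Union>a\<in>A. Poly_Mapping.keys (F a))"
      by (auto simp: in_keys_iff)
  qed
  with assms show ?thesis
    unfolding tensor_power_def tensor_algebra_def by blast
qed

lemma skew_deriv_tensor_power:
  assumes "f \<in> tensor_power Y (Suc m)"
  shows "skew_deriv Q i f \<in> tensor_power Y m"
proof -
  have "cscale a (skew_deriv_word Q i w) \<in> tensor_power Y m" if "w \<in> lists Y" "length w = Suc m" for a w
  proof -
    have "Poly_Mapping.single (drop_nth p w) b \<in> tensor_power Y m" if "p < Suc m" for p b
      using tensor_power_single[OF drop_nth_in_lists[OF \<open>w \<in> lists Y\<close>], of p b]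
        \<open>length w = Suc m\<close> that by (simp add: length_drop_nth)
    with that show ?thesis
      unfolding skew_deriv_word_eq_sum cscale_eq_scalar_mult
      by (intro tensor_power_scalar_mult tensor_power_sum) (simp add: tensor_power_0)
  qed
  moreover have "w \<in> lists Y \<and> length w = Suc m" if "w \<in> Poly_Mapping.keys f" for w
    using that assms by (auto simp: tensor_power_def tensor_algebra_def)
  ultimately show ?thesis
    unfolding skew_deriv_def lin_ext_def by (intro tensor_power_sum) blast
qed

text \<open>The coefficient of a word in the quantum symmetrizer is the iterated skew derivative.\<close>

lemma skew_derivs_eq_0:
  assumes c: "diagonal_on Y c Q"
    and "f \<in> tensor_power Y m" "quantum_symmetrizer c m f = 0" "length is = m"
  shows "skew_derivs Q is f = 0"
  using assms(2-)
proof (induction "is" arbitrary: f m)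
  case Nil
  have "Poly_Mapping.keys f \<subseteq> {[]}"
    using Nil by (auto simp: tensor_power_def)
  then have f: "f = scalar (Poly_Mapping.lookup f [])"
    by (intro poly_mapping_eqI) (auto simp: lookup_single when_def in_keys_iff subset_iff)
  have "quantum_symmetrizer c 0 f = f"
    by (subst (1 2) f, subst quantum_symmetrizer_diagonal[OF c])
      (auto simp: inversion_weight_def inversions_def)
  with Nil show ?case by simp
next
  case (Cons i "is")
  then obtain m' where m: "m = Suc m'" by (cases m) auto
  have "quantum_symmetrizer c m' (skew_deriv Q i f) = 0"
    using last_coeff_quantum_symmetrizer[OF c, of f m' i] Cons.prems
    by (simp add: m last_coeff_def)
  then show ?case
    using Cons m by (auto intro: skew_deriv_tensor_power)
qed

text \<open>In a degree above all words in the finite spanning set, only the ideal contributes. The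
  tensors whose component of degree \<open>m\<close> is killed by the symmetrizer form a subspace,
  which then contains the spanning set and the ideal.\<close>

lemma nichols_finite_dim_imp_quantum_symmetrizer_eq_0:
  assumes "nichols_finite_dim X c"
  obtains M where "\<And>m f. M \<le> m \<Longrightarrow> f \<in> tensor_power X m \<Longrightarrow> quantum_symmetrizer c m f = 0"
proof -
  from assms obtain B where B: "finite B" "tensor_algebra X \<subseteq> free_vs.span (B \<union> nichols_ideal X c)"
    by (auto simp: nichols_finite_dim_def)
  define proj :: "nat \<Rightarrow> ('a list \<Rightarrow>\<^sub>0 complex) \<Rightarrow> ('a list \<Rightarrow>\<^sub>0 complex)" where
    "proj m = lin_ext (\<lambda>w. if length w = m then Poly_Mapping.single w 1 else 0)" for m
  have proj_same: "proj m f = f" if "f \<in> tensor_power X m" for m f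
  proof -
    have "proj m f = (\<Sum>b\<in>Poly_Mapping.keys f. Poly_Mapping.single b (Poly_Mapping.lookup f b))"
      unfolding proj_def lin_ext_def
      using that by (intro sum.cong) (auto simp: tensor_power_def)
    then show ?thesis by (simp flip: poly_mapping_eq_sum_single)
  qed
  have proj_diff: "proj m f = 0" if "\<And>w. w \<in> Poly_Mapping.keys f \<Longrightarrow> length w \<noteq> m" for m f
    unfolding proj_def lin_ext_def using that by (intro sum.neutral) auto
  have subspace: "free_vs.subspace {f. quantum_symmetrizer c m (proj m f) = 0}" for m
    by (rule free_vs.subspaceI)
      (auto simp: proj_def lin_ext_add lin_ext_cscale quantum_symmetrizer_add quantum_symmetrizer_cscale)
  define L where "L = (\<Union>b\<in>B. length ` Poly_Mapping.keys b)"
  have "finite L" using B by (auto simp: L_def)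
  \<comment> \<open>The inserted 0 keeps \<open>Max\<close> meaningful when \<open>L\<close> is
    empty.\<close>
  have "quantum_symmetrizer c m f = 0" if m: "Suc (Max (insert 0 L)) \<le> m" and f: "f \<in> tensor_power X m" for m f
  proof -
    have "quantum_symmetrizer c m (proj m b) = 0" if "b \<in> B" for b
    proof -
      have "length w \<noteq> m" if "w \<in> Poly_Mapping.keys b" for w
      proof -
        have "length w \<in> insert 0 L" using that \<open>b \<in> B\<close> by (auto simp: L_def)
        then have "length w \<le> Max (insert 0 L)" using \<open>finite L\<close> by (intro Max_ge) auto
        with m show ?thesis by simp
      qed
      then show ?thesis by (simp add: proj_diff)
    qed
    moreover have "quantum_symmetrizer c m (proj m h) = 0" if "h \<in> nichols_ideal X c" for h
      using that unfolding nichols_ideal_def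
    proof (rule free_vs.span_induct[OF _ subspace])
      fix h
      assume "h \<in> (\<Union>m. {f \<in> tensor_power X m. quantum_symmetrizer c m f = 0})"
      then obtain k where k: "h \<in> tensor_power X k" "quantum_symmetrizer c k h = 0" by blast
      show "quantum_symmetrizer c m (proj m h) = 0"
      proof (cases "k = m")
        case True
        with k show ?thesis by (simp add: proj_same)
      next
        case False
        with k have "proj m h = 0" by (intro proj_diff) (auto simp: tensor_power_def)
        then show ?thesis by simp
      qed
    qed
    moreover have "f \<in> free_vs.span (B \<union> nichols_ideal X c)"
      using B(2) f by (auto simp: tensor_power_def)
    ultimately have "quantum_symmetrizer c m (proj m f) = 0"
      by (elim free_vs.span_induct[OF _ subspace] UnE)
    with f show ?thesis by (simp add: proj_same)
  qed
  then show thesis by (rule that)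
qed

lemma tensor_power_mono: "Y \<subseteq> X \<Longrightarrow> tensor_power Y m \<subseteq> tensor_power X m"
  by (auto simp: tensor_power_def tensor_algebra_def subset_iff)

text \<open>Finite dimension would kill every tensor of high degree, but iterated derivations map
  \<open>z ^ M\<close> to a nonzero scalar. Words over \<open>Y\<close> are symmetrized by the
  braiding of the whole space, so the bound obtained for \<open>X\<close> applies to them
  directly.\<close>

lemma not_nichols_finite_dim:
  fixes z :: "'x list \<Rightarrow>\<^sub>0 complex"
  assumes c: "diagonal_on Y c Q" and "Y \<subseteq> X"
    and act: "\<And>i. i \<in> set (b # js) \<Longrightarrow> grading_action Q i z = scalar (\<kappa> i) * z"
    and zero: "\<And>i. i \<in> set js \<Longrightarrow> skew_deriv Q i z = 0"
    and iso: "prod_list (map \<kappa> (b # js)) = 1"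
    and e: "skew_derivs Q (b # js) z = scalar e" "e \<noteq> 0"
    and z: "z \<in> tensor_power Y (Suc (length js))"
  shows "\<not> nichols_finite_dim X c"
proof
  assume "nichols_finite_dim X c"
  then obtain M where M: "\<And>m f. M \<le> m \<Longrightarrow> f \<in> tensor_power X m \<Longrightarrow> quantum_symmetrizer c m f = 0"
    by (rule nichols_finite_dim_imp_quantum_symmetrizer_eq_0) blast
  \<comment> \<open>The bound \<open>M\<close> serves as exponent as well, since the degree of
    \<open>z ^ M\<close> is at least \<open>M\<close>.\<close>
  let ?m = "M * Suc (length js)"
  have zM: "z ^ M \<in> tensor_power Y ?m"
    by (rule tensor_power_power[OF z])
  then have "quantum_symmetrizer c ?m (z ^ M) = 0"
    using tensor_power_mono[OF \<open>Y \<subseteq> X\<close>] by (intro M) auto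
  then have "skew_derivs Q (concat (replicate M (b # js))) (z ^ M) = 0"
    by (intro skew_derivs_eq_0[OF c zM]) (auto simp: length_concat sum_list_replicate)
  then have "(scalar (fact M * e ^ M) :: 'x list \<Rightarrow>\<^sub>0 complex) = 0"
    using skew_derivs_isotropic_power[OF act zero iso e(1)] by simp
  then have "fact M * e ^ M = 0"
    by (metis lookup_single_eq lookup_zero)
  with e(2) show False
    by simp
qed

section \<open>Infinite-dimensionality criteria for diagonal braidings\<close>

lemma quantum_fact_neq_0:
  assumes "\<And>k. 0 < k \<Longrightarrow> k \<le> n \<Longrightarrow> q ^ k \<noteq> 1"
  shows "quantum_fact q n \<noteq> 0"
proof -
  have "(\<Sum>j\<le>k. q ^ j) \<noteq> 0" if "k < n" for k
  proof
    assume "(\<Sum>j\<le>k. q ^ j) = 0"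
    moreover have "(1 - q) * (\<Sum>j\<le>k. q ^ j) = 1 - q ^ Suc k"
      by (rule sum_gp_basic)
    ultimately show False
      using assms[of "Suc k"] that by simp
  qed
  then show ?thesis
    by (simp add: quantum_fact_def)
qed

lemma not_nichols_finite_dim_single:
  assumes "diagonal_on Y c Q" "Y \<subseteq> X" "b \<in> Y" "Q b b = 1"
  shows "\<not> nichols_finite_dim X c"
  using assms(3,4)
  by (intro not_nichols_finite_dim[OF assms(1,2), where z = "letter b" and b = b and js = "[]"
        and \<kappa> = "\<lambda>_. 1" and e = 1])
    (auto simp: skew_deriv_letter scalar_1 intro: tensor_power_letter)

text \<open>The degree is \<open>m a + b\<close>, and \<open>iso\<close> is its self-braiding; the
  two families of inequalities keep \<open>ad_coeff\<close> and \<open>quantum_fact\<close>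
  nonzero.\<close>

lemma not_nichols_finite_dim_pair:
  assumes "diagonal_on Y c Q" "Y \<subseteq> X" and ab: "a \<in> Y" "b \<in> Y" "a \<noteq> b"
    and "\<And>k. k < m \<Longrightarrow> Q a a ^ k * (Q a b * Q b a) \<noteq> 1"
    and "\<And>k. 0 < k \<Longrightarrow> k \<le> m \<Longrightarrow> Q a a ^ k \<noteq> 1"
    and iso: "Q a a ^ (m * m) * Q b b * (Q a b * Q b a) ^ m = 1"
  shows "\<not> nichols_finite_dim X c"
proof (rule not_nichols_finite_dim[OF assms(1,2), where \<kappa> = "\<lambda>i. Q i a ^ m * Q i b"])
  show "grading_action Q i (ad_power Q a b m) = scalar (Q i a ^ m * Q i b) * ad_power Q a b m" for i
    by (rule grading_action_ad_power)
  show "skew_deriv Q i (ad_power Q a b m) = 0" if "i \<in> set (replicate m a)" for i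
    using that ab by (auto simp: skew_deriv_ad_power)
  show "prod_list (map (\<lambda>i. Q i a ^ m * Q i b) (b # replicate m a)) = 1"
    using iso by (simp add: power_mult power_mult_distrib ac_simps)
  show "skew_derivs Q (b # replicate m a) (ad_power Q a b m)
      = scalar (ad_coeff Q a b m * quantum_fact (Q a a) m)"
    using ab by (intro skew_derivs_ad_power) auto
  show "ad_coeff Q a b m * quantum_fact (Q a a) m \<noteq> 0"
    using assms(6,7) quantum_fact_neq_0[of m "Q a a"] by (auto simp: ad_coeff_def)
  show "ad_power Q a b m \<in> tensor_power Y (Suc (length (replicate m a)))"
    using tensor_power_ad_power[OF ab(1,2)] by simp
qed

lemma not_nichols_finite_dim_triple:
  assumes "diagonal_on Y c Q" "Y \<subseteq> X"
    and abc: "a \<in> Y" "b \<in> Y" "d \<in> Y" "a \<noteq> b" "a \<noteq> d" "d \<noteq> b"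
    and "\<And>k. k < n \<Longrightarrow> Q a a ^ k * (Q a b * Q b a) \<noteq> 1"
    and "\<And>k. 0 < k \<Longrightarrow> k \<le> n \<Longrightarrow> Q a a ^ k \<noteq> 1"
    and "(Q d a * Q a d) ^ n * (Q d b * Q b d) \<noteq> 1"
    and iso: "Q a a ^ (n * n) * Q b b * Q d d * (Q a b * Q b a) ^ n
        * (Q d a * Q a d) ^ n * (Q d b * Q b d) = 1"
  shows "\<not> nichols_finite_dim X c"
proof (rule not_nichols_finite_dim[OF assms(1,2), where \<kappa> = "\<lambda>i. Q i d * (Q i a ^ n * Q i b)"])
  show "grading_action Q i (ad_triple Q a b d n)
      = scalar (Q i d * (Q i a ^ n * Q i b)) * ad_triple Q a b d n" for i
    by (rule grading_action_ad_triple)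
  show "skew_deriv Q i (ad_triple Q a b d n) = 0" if "i \<in> set (replicate n a @ [d])" for i
    using that abc by (intro skew_deriv_ad_triple_eq_0) (auto split: if_splits)
  show "prod_list (map (\<lambda>i. Q i d * (Q i a ^ n * Q i b)) (b # replicate n a @ [d])) = 1"
    using iso by (simp add: power_mult power_mult_distrib ac_simps)
  show "skew_derivs Q (b # replicate n a @ [d]) (ad_triple Q a b d n)
      = scalar (ad_coeff Q a b n * quantum_fact (Q a a) n
          * (1 - (Q d a * Q a d) ^ n * (Q d b * Q b d)))"
    using abc by (intro skew_derivs_ad_triple) auto
  show "ad_coeff Q a b n * quantum_fact (Q a a) n
      * (1 - (Q d a * Q a d) ^ n * (Q d b * Q b d)) \<noteq> 0"
    using assms(9-11) quantum_fact_neq_0[of n "Q a a"] by (auto simp: ad_coeff_def)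
  show "ad_triple Q a b d n \<in> tensor_power Y (Suc (length (replicate n a @ [d])))"
    using tensor_power_ad_triple[OF abc(1-3)] by simp
qed

lemma powi_power: "(p powi i) ^ k = p powi (i * int k)" for p :: complex
  by (simp add: power_int_mult)

lemma powi_mult: "p \<noteq> 0 \<Longrightarrow> p powi i * p powi j = p powi (i + j)" for p :: complex
  by (simp add: power_int_add)

text \<open>The letters stand for \<open>\<pi>\<close>, \<open>\<pi> ^ (2 \<epsilon>)\<close> and \<open>\<pi> ^ 4\<close>, and \<open>p\<close> for a fourth root of the scalar
  of \<open>\<pi>\<close>: this gives \<open>\<pi> ^ i\<close> and \<open>\<pi> ^ j\<close> the braiding \<open>p ^ (4 i / j)\<close>. For \<open>d = 3\<close> and
  \<open>\<epsilon> = -1\<close> the three letters form an affine diagram of type \<open>A\<^sub>2\<close>, and every pair has a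
  finite-dimensional Nichols algebra.\<close>

lemma not_nichols_finite_dim_powers_of_two:
  assumes c: "diagonal_on Y c Q" "Y \<subseteq> X"
    and x: "x1 \<in> Y" "x2 \<in> Y" "x4 \<in> Y" and neq: "x1 \<noteq> x2" "x2 \<noteq> x4" "x1 \<noteq> x4"
    and p: "\<And>i. p powi i = 1 \<longleftrightarrow> int d dvd i" "p \<noteq> 0" and d: "odd d" "d \<noteq> 1"
    and \<epsilon>: "\<epsilon> = 1 \<or> \<epsilon> = (-1 :: int)"
    and Q: "Q x1 x1 = p powi 4" "Q x2 x2 = p powi 4" "Q x4 x4 = p powi 4"
      "Q x1 x2 = p powi (2 * \<epsilon>)" "Q x2 x1 = p powi (8 * \<epsilon>)"
      "Q x2 x4 = p powi (2 * \<epsilon>)" "Q x4 x2 = p powi (8 * \<epsilon>)"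
      "Q x1 x4 = p powi 1" "Q x4 x1 = p powi 16"
  shows "\<not> nichols_finite_dim X c"
proof -
  have "p ^ k = 1 \<longleftrightarrow> int d dvd int k" for k
    using p(1)[of "int k"] by simp
  \<comment> \<open>All conditions on \<open>Q\<close> become divisibility of exponents of
    \<open>p\<close> by \<open>d\<close>; the rules deleted from the simpset would destroy the
    normal form \<open>p powi i\<close>.\<close>
  note eq = Q powi_power powi_mult[OF p(2)] p(1) this le_Suc_eq
  note [simp del] = power_int_1_right power_int_numeral
  have small: "\<not> int d dvd i" if "0 < i" "i < int d" for i
    using that zdvd_imp_le by fastforce
  have cop2: "coprime (int d) 2" "coprime (int d) 4"
    using d coprime_power_right_iff[of "int d" 2 2] by auto
  have dvd2: "int d dvd 2 * i \<longleftrightarrow> int d dvd i" "int d dvd 4 * i \<longleftrightarrow> int d dvd i" for i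
    using cop2 by (simp_all add: coprime_dvd_mult_right_iff)
  have "d = 3 \<or> d = 5 \<or> d \<ge> 7"
    using d by presburger
  then consider "d = 3" "\<epsilon> = 1" | "d = 3" "\<epsilon> = -1" | "d = 5" | "d \<ge> 7" "\<epsilon> = -1" | "d \<ge> 7" "\<epsilon> = 1"
    using \<epsilon> by blast
  then show ?thesis
  proof cases
    case 1
    \<comment> \<open>Degree \<open>x1 + x2\<close>, with exponent
      \<open>4 + 4 + 10 = 18\<close>.\<close>
    show ?thesis
      by (rule not_nichols_finite_dim_pair[OF c x(1,2) neq(1), where m = 1]) (auto simp: eq 1)
  next
    case 2
    \<comment> \<open>Degree \<open>x1 + x2 + x4\<close>, the null root of the affine diagram, with
      exponent \<open>12 - 10 - 10 + 17 = 9\<close>.\<close>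
    show ?thesis
      by (rule not_nichols_finite_dim_triple[OF c x(2,1,3), where n = 1])
        (use neq in \<open>auto simp: eq 2\<close>)
  next
    case 3
    \<comment> \<open>Degree \<open>x1 + x4\<close>, with exponent
      \<open>4 + 4 + 17 = 25\<close>.\<close>
    show ?thesis
      by (rule not_nichols_finite_dim_pair[OF c x(1,3) neq(3), where m = 1]) (auto simp: eq 3)
  next
    case 4
    have "int d dvd i \<longleftrightarrow> i = 0" if "\<bar>i\<bar> < 7" for i
      using 4 that zdvd_not_zless[of "\<bar>i\<bar>" "int d"] by (cases "i = 0") auto
    \<comment> \<open>Degree \<open>2 x2 + x4\<close>, with exponent \<open>16 + 4 - 20 = 0\<close>
      for every \<open>d\<close>. The commutator factors have exponents -10 and -6, so 3 and 5 had
      to be treated apart.\<close>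
    show ?thesis
    proof (rule not_nichols_finite_dim_pair[OF c x(2,3) neq(2), where m = 2])
      show "Q x2 x2 ^ k * (Q x2 x4 * Q x4 x2) \<noteq> 1" if "k < 2" for k
      proof -
        have "k = 0 \<or> k = 1" using that by auto
        moreover have "\<not> int d dvd 10" "\<not> int d dvd 6"
          using small[of 5] small[of 3] dvd2(1)[of 5] dvd2(1)[of 3] 4 by auto
        ultimately show ?thesis by (auto simp: eq 4)
      qed
      show "Q x2 x2 ^ k \<noteq> 1" if "0 < k" "k \<le> 2" for k
        using that small[of "int k"] dvd2(2)[of "int k"] 4 by (auto simp: eq)
    qed (simp add: eq 4)
  next
    case 5
    \<comment> \<open>The degree \<open>n x2 + x1 + x4\<close> has exponent
      \<open>4 n^2 + 20 n + 25 = (2 n + 5)^2\<close>, and \<open>n\<close> is chosen to make this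
      \<open>d^2\<close>.\<close>
    define n where "n = (d - 5) div 2"
    have n: "int d = 2 * int n + 5"
      using 5 d unfolding n_def by presburger
    show ?thesis
    proof (rule not_nichols_finite_dim_triple[OF c x(2,1,3), where n = n])
      show "Q x2 x2 ^ k * (Q x2 x1 * Q x1 x2) \<noteq> 1" if "k < n" for k
        using that n small[of "2 * int k + 5"] dvd2(1)[of "2 * int k + 5"] by (simp add: eq 5)
      show "Q x2 x2 ^ k \<noteq> 1" if "0 < k" "k \<le> n" for k
        using that n small[of "int k"] dvd2(2)[of "int k"] by (auto simp: eq)
      have "\<not> int d dvd 8"
        using dvd2(1)[of 4] dvd2(2)[of 1] 5 by auto
      moreover have "int d dvd 8" if "int d dvd 10 * int n + 17"
      proof -
        have "8 = 5 * int d - (10 * int n + 17)"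
          using n by simp
        then show ?thesis
          using dvd_diff[OF dvd_triv_right[of "int d" 5] that] by metis
      qed
      ultimately show "(Q x4 x2 * Q x2 x4) ^ n * (Q x4 x1 * Q x1 x4) \<noteq> 1"
        by (auto simp: eq 5)
      have "4 * (int n * int n) + 4 + 4 + 10 * int n + 10 * int n + 17 = int d * int d"
        unfolding n by (simp add: algebra_simps)
      then show "Q x2 x2 ^ (n * n) * Q x1 x1 * Q x4 x4 * (Q x2 x1 * Q x1 x2) ^ n
          * (Q x4 x2 * Q x2 x4) ^ n * (Q x4 x1 * Q x1 x4) = 1"
        by (simp add: eq 5)
    qed (use neq in auto)
  qed
qed

lemma ex_root_order:
  fixes p :: complex
  assumes "p ^ N = 1" "0 < N"
  obtains d where "\<And>i. p powi i = 1 \<longleftrightarrow> int d dvd i" "0 < d" "d dvd N"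
proof -
  define d where "d = (LEAST d. 0 < d \<and> p ^ d = 1)"
  have d: "0 < d" "p ^ d = 1"
    using LeastI[of "\<lambda>d. 0 < d \<and> p ^ d = 1" N] assms by (auto simp: d_def)
  have p0: "p \<noteq> 0"
    using assms by (auto simp: power_0_left)
  have "p powi i = p ^ nat (i mod int d)" for i
  proof -
    have "p powi i = p powi (int d * (i div int d) + i mod int d)"
      by simp
    also have "\<dots> = (p ^ d) powi (i div int d) * p powi (i mod int d)"
      using p0 by (subst power_int_add) (auto simp: power_int_mult)
    finally show ?thesis
      using d by (simp add: power_int_def)
  qed
  moreover have "p ^ nat (i mod int d) = 1 \<longleftrightarrow> int d dvd i" for i
  proof
    assume *: "p ^ nat (i mod int d) = 1"
    have "nat (i mod int d) < d"
      using d by (simp add: nat_less_iff)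
    then have "\<not> 0 < nat (i mod int d)"
      using not_less_Least[of "nat (i mod int d)" "\<lambda>d. 0 < d \<and> p ^ d = 1"] * by (auto simp: d_def)
    then show "int d dvd i"
      using d pos_mod_sign[of "int d" i] by (simp add: dvd_eq_mod_eq_0 del: pos_mod_sign)
  qed (auto simp: dvd_eq_mod_eq_0)
  ultimately have *: "p powi i = 1 \<longleftrightarrow> int d dvd i" for i
    by simp
  then have "d dvd N"
    using *[of "int N"] assms by simp
  with * d show thesis by (intro that) auto
qed

section \<open>Schur's Lemma for a central element of finite order\<close>

lemma sum_powers_root_of_unity:
  fixes z :: complex
  assumes "z ^ N = 1" "z \<noteq> 1"
  shows "(\<Sum>i<N. z ^ i) = 0"
  using assms by (simp add: sum_gp_strict)

text \<open>Fourier inversion over a cyclic group: up to the factor \<open>N\<close>, the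
  \<open>w i\<close> are the components of \<open>v\<close> in the eigenspaces of \<open>A\<close>;
  they add up to \<open>N v\<close>, so one of them is nonzero.\<close>

lemma ex_eigenvector_finite_order:
  fixes A :: "complex ^ 'd ^ 'd" and v :: "complex ^ 'd"
  assumes N: "0 < N" and A: "((*v) A ^^ N) v = v" and v: "v \<noteq> 0"
  obtains q w where "A *v w = q *s w" "w \<noteq> 0"
proof -
  define \<zeta> where "\<zeta> = exp (2 * of_real pi * \<i> * of_nat 1 / of_nat N)"
  have \<zeta>N: "\<zeta> ^ N = 1"
    unfolding \<zeta>_def using N by (intro complex_root_unity) auto
  have \<zeta>_ne: "\<zeta> ^ k \<noteq> 1" if "0 < k" "k < N" for k
  proof -
    have "\<zeta> ^ k = exp (2 * of_real pi * \<i> * of_nat k / of_nat N)"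
      unfolding \<zeta>_def by (simp flip: exp_of_nat_mult) (simp add: field_simps)
    then show ?thesis
      using that complex_root_unity_eq_1[of N k] N by (auto dest: dvd_imp_le)
  qed
  have \<zeta>0: "\<zeta> \<noteq> 0" by (simp add: \<zeta>_def)
  define f where "f k = ((*v) A ^^ k) v" for k
  define w where "w i = (\<Sum>k<N. (\<zeta> ^ k) ^ i *s f k)" for i
  have fS: "A *v f k = f (Suc k)" for k by (simp add: f_def)
  have eigen: "A *v w i = inverse (\<zeta> ^ i) *s w i" for i
  proof -
    \<comment> \<open>The factor \<open>\<zeta> ^ i\<close> matches the shift from
      \<open>f k\<close> to \<open>f (Suc k)\<close>; the shifted sum closes up because the terms
      for \<open>N\<close> and 0 agree.\<close>
    have "\<zeta> ^ i *s (A *v w i) = (\<Sum>k<N. (\<zeta> ^ Suc k) ^ i *s f (Suc k))"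
      unfolding w_def vec.linear_sum[OF matrix_vector_mul_linear_gen] vec.scale_sum_right
      by (intro sum.cong refl) (simp add: vec.linear_scale[OF matrix_vector_mul_linear_gen] fS power_mult_distrib)
    also have "\<dots> = (\<Sum>k<Suc N. (\<zeta> ^ k) ^ i *s f k) - (\<zeta> ^ 0) ^ i *s f 0"
      by (simp add: sum.lessThan_Suc_shift del: sum.lessThan_Suc)
    also have "\<dots> = w i"
      using A \<zeta>N by (simp add: w_def f_def)
    finally have "inverse (\<zeta> ^ i) *s (\<zeta> ^ i *s (A *v w i)) = inverse (\<zeta> ^ i) *s w i"
      by simp
    then show ?thesis using \<zeta>0 by simp
  qed
  have "(\<Sum>i<N. w i) = (\<Sum>k<N. (\<Sum>i<N. (\<zeta> ^ k) ^ i) *s f k)"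
    unfolding w_def by (subst sum.swap) (simp add: vec.scale_sum_left)
  also have "\<dots> = (\<Sum>k<N. if k = 0 then of_nat N *s v else 0)"
  proof (intro sum.cong refl)
    fix k assume "k \<in> {..<N}"
    show "(\<Sum>i<N. (\<zeta> ^ k) ^ i) *s f k = (if k = 0 then of_nat N *s v else 0)"
    proof (cases "k = 0")
      case False
      have "(\<zeta> ^ k) ^ N = 1"
        by (metis \<zeta>N power_mult mult.commute power_one)
      with False \<open>k \<in> {..<N}\<close> show ?thesis
        using sum_powers_root_of_unity[OF _ \<zeta>_ne] by simp
    qed (simp add: f_def)
  qed
  also have "\<dots> = of_nat N *s v"
    using N by (simp add: sum.delta)
  finally have "(\<Sum>i<N. w i) \<noteq> 0"
    using N v by (simp add: vec.scale_eq_0_iff)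
  then obtain i where "w i \<noteq> 0"
    by (meson sum.neutral)
  with eigen show thesis
    by (rule that)
qed

section \<open>Scalar action of the base point and braiding of its powers\<close>

locale yd_setup = group G for G (structure) +
  fixes s :: 'a and \<rho> :: "'a \<Rightarrow> complex ^ 'd ^ 'd" and g :: "'a \<Rightarrow> 'a"
  assumes s: "s \<in> carrier G" and fin: "finite (conj_class G s)"
    and ord_pos: "0 < ord s"
    and irr: "irreducible_rep (G\<lparr>carrier := centralizer G s\<rparr>) \<rho>"
    and sec: "conj_section G s g"
begin

lemma rep_mult: "x \<in> centralizer G s \<Longrightarrow> y \<in> centralizer G s \<Longrightarrow> \<rho> (x \<otimes> y) = \<rho> x ** \<rho> y"
  using irr by (auto simp: irreducible_rep_def hom_def GL_def)

lemma pow_in_centralizer: "s [^] (e :: nat) \<in> centralizer G s"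
  using s by (simp add: centralizer_def) (metis nat_pow_Suc nat_pow_Suc2)

lemma in_centralizer: "s \<in> centralizer G s"
  using pow_in_centralizer[of 1] s by simp

text \<open>\<open>hom\<close> only asks for multiplicativity; the unit is preserved because an
  invertible idempotent matrix is the identity.\<close>

lemma rep_one: "\<rho> \<one> = mat 1"
proof -
  have one: "\<one> \<in> centralizer G s"
    using pow_in_centralizer[of 0] by simp
  then have "invertible (\<rho> \<one>)"
    using irr by (auto simp: irreducible_rep_def hom_def GL_def)
  then obtain B where B: "B ** \<rho> \<one> = mat 1"
    by (auto simp: invertible_def)
  have "\<rho> \<one> ** \<rho> \<one> = \<rho> \<one>"
    using rep_mult[OF one one] by simp
  then have "B ** (\<rho> \<one> ** \<rho> \<one>) = B ** \<rho> \<one>"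
    by simp
  then show ?thesis
    by (simp add: matrix_mul_assoc B)
qed

lemma rep_pow: "\<rho> (s [^] (e :: nat)) *v v = ((*v) (\<rho> s) ^^ e) v"
proof (induction e arbitrary: v)
  case (Suc e)
  then show ?case
    using rep_mult[OF pow_in_centralizer[of e] in_centralizer] s
    by (simp add: matrix_vector_mul_assoc[symmetric] funpow_swap1)
qed (simp add: rep_one)

text \<open>An eigenvalue exists because \<open>s\<close> has finite order, and its eigenspace is
  invariant because \<open>s\<close> is central in its centralizer; irreducibility makes it the
  whole space.\<close>

lemma rep_scalar:
  obtains q where "\<And>v. \<rho> s *v v = q *s v" "q ^ ord s = 1" "acting_scalar (\<rho> s) = q"
proof -
  obtain v :: "complex ^ 'd" where v: "v \<noteq> 0"
    by (metis zero_neq_one)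
  have "((*v) (\<rho> s) ^^ ord s) v = v"
    using rep_pow[of "ord s" v] s by (simp add: rep_one)
  then obtain q w where w: "\<rho> s *v w = q *s w" "w \<noteq> 0"
    using ex_eigenvector_finite_order[OF ord_pos _ v] by blast
  define W where "W = {x. \<rho> s *v x = q *s x}"
  have "vec.subspace W"
    unfolding W_def
    by (rule vec.subspaceI) (auto simp: matrix_vector_right_distrib vec.scale_right_distrib
        vec.linear_scale[OF matrix_vector_mul_linear_gen] mult.commute)
  moreover have "\<rho> h *v x \<in> W" if "h \<in> centralizer G s" "x \<in> W" for h x
  proof -
    have "\<rho> s ** \<rho> h = \<rho> h ** \<rho> s"
      using that rep_mult in_centralizer by (metis (mono_tags, lifting) centralizer_def mem_Collect_eq)
    then have "\<rho> s *v (\<rho> h *v x) = \<rho> h *v (\<rho> s *v x)"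
      by (simp add: matrix_vector_mul_assoc)
    then show ?thesis
      using that by (simp add: W_def vec.linear_scale[OF matrix_vector_mul_linear_gen])
  qed
  ultimately have "W = {0} \<or> W = UNIV"
    using irr by (simp add: irreducible_rep_def)
  then have "W = UNIV"
    using w by (auto simp: W_def)
  then have q: "\<rho> s *v x = q *s x" for x
    by (auto simp: W_def)
  have "((*v) (\<rho> s) ^^ e) x = (q ^ e) *s x" for e x
    by (induction e) (auto simp: q)
  then have "(q ^ ord s) *s v = v"
    using rep_pow[of "ord s" v] s by (simp add: rep_one)
  then have "(q ^ ord s - 1) *s v = 0"
    by (simp add: vec.scale_left_diff_distrib)
  then have "q ^ ord s = 1"
    using v by (simp add: vec.scale_eq_0_iff)
  moreover have "acting_scalar (\<rho> s) = q"
    unfolding acting_scalar_def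
  proof (rule the_equality)
    fix q' assume "\<forall>x. \<rho> s *v x = q' *s x"
    then have "q *s v = q' *s v"
      by (metis q)
    then show "q' = q"
      using v by auto
  qed (simp add: q)
  ultimately show thesis
    using q by (intro that)
qed

lemma int_pow_in_centralizer: "s [^] (i :: int) \<in> centralizer G s"
proof -
  have "s [^] i \<otimes> s = s [^] (i + 1)" "s \<otimes> s [^] i = s [^] (1 + i)"
    using s by (simp_all only: int_pow_mult int_pow_1)
  then show ?thesis
    using s by (simp add: centralizer_def add.commute)
qed

lemma rep_int_pow:
  assumes q: "\<And>v. \<rho> s *v v = q *s v" "q ^ ord s = 1"
  shows "\<rho> (s [^] (i :: int)) $ l $ k = (if l = k then q powi i else 0)"
proof -
  define e where "e = nat (i mod int (ord s))"
  have i: "i = int e + int (ord s) * (i div int (ord s))"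
    using ord_pos by (simp add: e_def)
  have q0: "q \<noteq> 0"
    using q(2) ord_pos by (auto simp: power_0_left)
  have "s [^] i = s [^] int e \<otimes> (s [^] int (ord s)) [^] (i div int (ord s))"
    using s by (subst i) (simp only: int_pow_mult int_pow_pow)
  then have se: "s [^] i = s [^] e"
    using s by (simp add: int_pow_int)
  have "q powi i = q powi int e * (q powi int (ord s)) powi (i div int (ord s))"
    using q0 by (subst i) (simp add: power_int_add power_int_mult)
  then have qe: "q powi i = q ^ e"
    using q(2) by simp
  have "((*v) (\<rho> s) ^^ e) x = (q ^ e) *s x" for x
    by (induction e) (auto simp: q(1))
  then have "\<rho> (s [^] i) *v axis k 1 = q powi i *s axis k 1"
    by (simp add: se qe rep_pow)
  moreover have "(\<rho> (s [^] i) *v axis k 1) $ l = \<rho> (s [^] i) $ l $ k"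
    by (simp add: matrix_vector_mult_def axis_def if_distrib cong: if_cong)
  ultimately show ?thesis
    by (auto simp: axis_def)
qed

lemma conj_int_pow:
  assumes "h \<in> carrier G" "x \<in> carrier G"
  shows "(h \<otimes> x \<otimes> inv h) [^] (i :: int) = h \<otimes> x [^] i \<otimes> inv h"
proof -
  have "(\<lambda>x. h \<otimes> x \<otimes> inv h) \<in> hom G G"
    using assms(1) by (auto simp: hom_def m_assoc inv_solve_left' intro!: r_cancel_one')
       (simp add: m_assoc[symmetric])
  then show ?thesis
    using hom_int_pow[OF _ assms(2) is_group is_group] by fastforce
qed

text \<open>If \<open>q = p ^ u\<close>, the braiding of the powers \<open>s ^ a\<close> and \<open>s ^ b\<close> is the power of \<open>p\<close> with
  exponent \<open>a u / b\<close>, where \<open>u / b\<close> is taken modulo the order of \<open>s\<close>.\<close>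

lemma yd_braiding_powers:
  assumes q: "\<And>v. \<rho> s *v v = q *s v" "q ^ ord s = 1"
    and h: "h \<in> carrier G" "h \<otimes> s \<otimes> inv h = s [^] b" and b: "coprime b (int (ord s))"
    and p: "p ^ ord s = 1" "q = p powi u" and c: "[b * c = u] (mod int (ord s))"
  shows "yd_braiding G s \<rho> g (s [^] (a :: int), k) (s [^] b, k)
    = Poly_Mapping.single ((s [^] b, k), (s [^] a, k)) (p powi (a * c))"
proof -
  let ?N = "int (ord s)" and ?t = "s [^] b" and ?C = "conj_class G s"
  obtain b' where b': "[b * b' = 1] (mod ?N)"
    using b by (metis cong_solve_coprime_int)
  have t: "?t \<in> ?C"
    using h s unfolding conj_class_def by (metis (mono_tags, lifting) mem_Collect_eq)
  then have gt: "g ?t \<in> carrier G" "g ?t \<otimes> s \<otimes> inv (g ?t) = ?t"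
    using sec by (auto simp: conj_section_def)
  \<comment> \<open>As \<open>b'\<close> inverts \<open>b\<close>, \<open>s ^ a\<close> is a power
    of \<open>s ^ b\<close>; conjugating back by \<open>g\<close> turns it into the power
    \<open>b' a\<close> of \<open>s\<close>.\<close>
  have "[b * (b' * a) = a] (mod ?N)"
    using cong_mult[OF b' cong_refl[of a]] by (simp add: mult.assoc)
  then have "s [^] a = s [^] (b * (b' * a))"
    using s int_pow_eq[OF s] by (metis cong_iff_dvd_diff)
  also have "\<dots> = (g ?t \<otimes> s \<otimes> inv (g ?t)) [^] (b' * a)"
    using s by (simp add: gt(2) int_pow_pow)
  also have "\<dots> = g ?t \<otimes> s [^] (b' * a) \<otimes> inv (g ?t)"
    by (rule conj_int_pow[OF gt(1) s])
  finally have sa: "s [^] a = g ?t \<otimes> s [^] (b' * a) \<otimes> inv (g ?t)" .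
  have \<gamma>t: "inv (g ?t) \<otimes> s [^] a \<otimes> g ?t = s [^] (b' * a)"
    unfolding sa using gt s by (simp add: m_assoc inv_solve_left')
  \<comment> \<open>The powers of \<open>s\<close> commute, so \<open>s ^ a\<close> preserves the
    summand of \<open>s ^ b\<close> and only this summand contributes to the action.\<close>
  have unique: "u = ?t" if "u \<in> ?C" "inv (g u) \<otimes> s [^] a \<otimes> g ?t \<in> centralizer G s" for u
  proof -
    have gu: "g u \<in> carrier G" "g u \<otimes> s \<otimes> inv (g u) = u"
      using sec that(1) by (auto simp: conj_section_def)
    let ?\<gamma> = "inv (g u) \<otimes> s [^] a \<otimes> g ?t"
    have \<gamma>: "?\<gamma> \<in> carrier G" "?\<gamma> \<otimes> s = s \<otimes> ?\<gamma>"
      using that(2) by (auto simp: centralizer_def)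
    have sag: "s [^] a \<otimes> g ?t = g u \<otimes> ?\<gamma>"
      using gu gt s by (simp add: m_assoc[symmetric])
    have gts: "g ?t \<otimes> s = ?t \<otimes> g ?t"
      using gt s by (metis inv_solve_right m_closed int_pow_closed)
    have gus: "g u \<otimes> s = u \<otimes> g u" and u: "u \<in> carrier G"
      using gu s by (metis inv_solve_right inv_closed m_closed, metis inv_closed m_closed)
    have "u \<otimes> (s [^] a \<otimes> g ?t) = (u \<otimes> g u) \<otimes> ?\<gamma>"
      using u gu \<gamma> sag by (simp add: m_assoc)
    also have "\<dots> = g u \<otimes> ?\<gamma> \<otimes> s"
      using gu s \<gamma> by (simp add: gus[symmetric] m_assoc)
    also have "\<dots> = s [^] a \<otimes> (g ?t \<otimes> s)"
      using s gt by (simp add: sag[symmetric] m_assoc)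
    also have "\<dots> = s [^] (a + b) \<otimes> g ?t"
      using s gt by (simp add: gts m_assoc int_pow_mult)
    also have "\<dots> = ?t \<otimes> (s [^] a \<otimes> g ?t)"
      using s gt by (simp add: m_assoc int_pow_mult add.commute[of a])
    finally show ?thesis
      using u s gt by (meson right_cancel int_pow_closed m_closed)
  qed
  have p0: "p \<noteq> 0"
    using p(1) ord_pos by (auto simp: power_0_left)
  \<comment> \<open>\<open>c\<close> stands for \<open>u / b\<close>, so the exponent
    \<open>u a / b\<close> of \<open>p\<close> may be replaced by \<open>a c\<close>.\<close>
  have "[u * (b' * a) = a * c] (mod ?N)"
  proof -
    have "[u * (b' * a) = (b * c) * (b' * a)] (mod ?N)"
      by (intro cong_mult cong_refl cong_sym[OF c])
    also have "(b * c) * (b' * a) = (b * b') * (a * c)" by simp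
    also have "[(b * b') * (a * c) = 1 * (a * c)] (mod ?N)"
      by (intro cong_mult b' cong_refl)
    finally show ?thesis by simp
  qed
  then obtain j where j: "u * (b' * a) = a * c + ?N * j"
    by (metis cong_iff_lin cong_sym)
  have "q powi (b' * a) = p powi (u * (b' * a))"
    by (simp only: p(2) power_int_mult)
  also have "\<dots> = p powi (a * c) * (p powi ?N) powi j"
    using p0 by (simp only: j) (simp add: power_int_add power_int_mult)
  finally have pq: "q powi (b' * a) = p powi (a * c)"
    using p(1) by simp
  have "yd_action G s \<rho> g (s [^] a) (?t, k) = (\<Sum>u\<in>?C. if u = ?t
      then \<Sum>l\<in>UNIV. Poly_Mapping.single (?t, l) (\<rho> (s [^] (b' * a)) $ l $ k) else 0)"
    unfolding yd_action_def Let_def prod.case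
    using unique int_pow_in_centralizer[of "b' * a"] by (intro sum.cong refl) (auto simp: \<gamma>t)
  also have "\<dots> = (\<Sum>l\<in>UNIV. Poly_Mapping.single (?t, l) (\<rho> (s [^] (b' * a)) $ l $ k))"
    using fin t by (simp add: sum.delta)
  also have "\<dots> = (\<Sum>l\<in>UNIV. if l = k then Poly_Mapping.single (?t, k) (q powi (b' * a)) else 0)"
    by (intro sum.cong refl) (simp add: rep_int_pow[OF q])
  also have "\<dots> = Poly_Mapping.single (?t, k) (p powi (a * c))"
    by (simp add: pq)
  finally show ?thesis
    by (simp add: yd_braiding_def)
qed

end

section \<open>Conjugating a permutation to its powers\<close>

text \<open>Makes multiplication of exponents by \<open>j\<close> well defined on the points of a
  cycle: the difference of two exponents of one point fixes \<open>y\<close>.\<close>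

lemma funpow_eq_mult:
  fixes p :: "'a \<Rightarrow> 'a"
  assumes "inj p" "(p ^^ a) y = (p ^^ b) y"
  shows "(p ^^ (j * a)) y = (p ^^ (j * b)) y"
proof -
  have *: "(p ^^ (j * a)) y = (p ^^ (j * b)) y" if "a \<le> b" "(p ^^ a) y = (p ^^ b) y" for a b :: nat
  proof -
    have "(p ^^ (b - a)) y = y"
      by (rule funpow_diff[OF assms(1) that])
    then have fix': "((p ^^ (b - a)) ^^ j) y = y"
      by (induction j) auto
    have "j * b = j * a + (b - a) * j"
      using that(1) by (simp add: algebra_simps diff_mult_distrib)
    then have "(p ^^ (j * b)) y = (p ^^ (j * a)) (((p ^^ (b - a)) ^^ j) y)"
      by (simp add: funpow_add funpow_mult)
    then show ?thesis by (simp add: fix')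
  qed
  then show ?thesis
    using assms(2) by (metis nat_le_linear)
qed

text \<open>On each cycle, with base point \<open>y\<close>, the conjugating permutation maps \<open>p ^ k y\<close> to
  \<open>p ^ (j k) y\<close>.\<close>

lemma ex_permutes_conj_power:
  assumes p: "p permutes S" "finite S" and N: "p ^^ N = id" "0 < N" and j: "coprime j N"
  obtains \<sigma> where "\<sigma> permutes S" "\<sigma> \<circ> p = (p ^^ j) \<circ> \<sigma>"
proof -
  have inj: "inj p" by (rule permutes_inj[OF p(1)])
  define orb where "orb x = range (\<lambda>k. (p ^^ k) x)" for x
  have orb_self: "x \<in> orb x" for x
    unfolding orb_def by (rule range_eqI[of _ _ 0]) simp
  have orb_sub: "orb ((p ^^ k) x) \<subseteq> orb x" for k x
    by (auto simp: orb_def simp flip: comp_apply[of "p ^^ _" "p ^^ _"] funpow_add)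
  have orb_eq: "orb y = orb x" if "y \<in> orb x" for x y
  proof -
    from that obtain k where k: "y = (p ^^ k) x" by (auto simp: orb_def)
    have "p ^^ (N * k) = id"
      using N(1) by (simp flip: funpow_mult)
    then have "x = (p ^^ (N * k - k)) y"
      using N(2) by (simp add: k flip: comp_apply[of "p ^^ _" "p ^^ _"] funpow_add)
    then show ?thesis
      using orb_sub[of k x] orb_sub[of "N * k - k" y] k by auto
  qed
  \<comment> \<open>The choice depends on the set \<open>orb x\<close> alone, so all points of a
    cycle share their base point.\<close>
  define base where "base x = (SOME y. y \<in> orb x)" for x
  define expo where "expo x = (SOME k. (p ^^ k) (base x) = x)" for x
  define \<sigma> where "\<sigma> x = (p ^^ (j * expo x)) (base x)" for x
  have base: "base x \<in> orb x" for x
    unfolding base_def using orb_self by (rule someI)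
  have orb_base: "orb (base x) = orb x" for x
    by (rule orb_eq[OF base])
  have expo: "(p ^^ expo x) (base x) = x" for x
    unfolding expo_def using orb_self[of x] unfolding orb_base[of x, symmetric]
    by (intro someI_ex[of "\<lambda>k. (p ^^ k) (base x) = x"]) (auto simp: orb_def intro: sym)
  have base_cong: "base x = base y" if "orb x = orb y" for x y
    using that by (simp add: base_def)
  have "\<sigma> (p x) = (p ^^ j) (\<sigma> x)" for x
  proof -
    have "p x \<in> orb x"
      unfolding orb_def by (rule range_eqI[of _ _ 1]) simp
    then have b: "base (p x) = base x"
      by (intro base_cong orb_eq)
    have "(p ^^ expo (p x)) (base x) = (p ^^ Suc (expo x)) (base x)"
      using expo[of "p x"] expo[of x] by (simp add: b)
    from funpow_eq_mult[OF inj this, of j] show ?thesis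
      by (simp add: \<sigma>_def b funpow_add)
  qed
  moreover have "\<sigma> permutes S"
  proof (rule inj_imp_permutes[OF _ p(2)])
    \<comment> \<open>Multiplying exponents by the inverse \<open>j'\<close> of \<open>j\<close>
      undoes \<open>\<sigma>\<close> on each cycle, which makes it injective.\<close>
    obtain j' where "[j * j' = 1] (mod N)"
      using j by (metis One_nat_def cong_solve_coprime_nat)
    then have j': "[j' * j * k = k] (mod N)" for k
      using cong_mult[OF _ cong_refl, of "j * j'" 1 N k] by (simp add: ac_simps)
    have mod: "(p ^^ k) y = (p ^^ l) y" if "[k = l] (mod N)" for k l y
    proof -
      have "(p ^^ k) = (p ^^ (k mod N))" for k
      proof -
        have "p ^^ k = p ^^ (N * (k div N) + k mod N)" by simp
        also have "\<dots> = (p ^^ N) ^^ (k div N) \<circ> p ^^ (k mod N)"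
          by (simp only: funpow_add funpow_mult)
        finally show ?thesis by (simp add: N(1))
      qed
      with that show ?thesis by (metis cong_def)
    qed
    show "inj_on \<sigma> S"
    proof (rule inj_onI)
      fix x z
      assume eq: "\<sigma> x = \<sigma> z"
      have "orb (\<sigma> x) = orb x" for x
        unfolding orb_base[of x, symmetric] by (rule orb_eq) (simp add: \<sigma>_def orb_def)
      then have b: "base z = base x"
        using eq by (metis base_cong)
      have "(p ^^ (j * expo x)) (base x) = (p ^^ (j * expo z)) (base x)"
        using eq by (simp add: \<sigma>_def b)
      from funpow_eq_mult[OF inj this, of j']
      have "(p ^^ expo x) (base x) = (p ^^ expo z) (base x)"
        using mod[OF j'] by (simp add: mult.assoc)
      then show "x = z"
        using expo[of z] unfolding b expo by (rule trans)
    qed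
    show "\<sigma> x \<in> S" if "x \<in> S" for x
    proof -
      have iff: "(p ^^ k) y \<in> S \<longleftrightarrow> y \<in> S" for k y
        using permutes_in_image[OF permutes_funpow[OF p(1)]] .
      show ?thesis
        unfolding \<sigma>_def iff using that unfolding iff[of "expo x" "base x", symmetric] expo .
    qed
    show "\<sigma> x = x" if "x \<notin> S" for x
    proof -
      have "(p ^^ k) x = x" for k
        using permutes_not_in[OF permutes_funpow[OF p(1)] that] .
      moreover from this have "base x = x"
        using base[of x] by (auto simp: orb_def)
      ultimately show ?thesis by (simp add: \<sigma>_def)
    qed
  qed
  ultimately show thesis
    by (intro that) (auto simp: fun_eq_iff)
qed

section \<open>Odd permutations commuting with a given permutation\<close>

lemma evenperm_cycle_of_list:
  "distinct cs \<Longrightarrow> cs \<noteq> [] \<Longrightarrow> evenperm (cycle_of_list cs) \<longleftrightarrow> odd (length cs)"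
proof (induction cs rule: cycle_of_list.induct)
  case (1 i j cs)
  then show ?case
    by (simp add: evenperm_comp permutation_swap_id permutation_of_cycle evenperm_swap del: o_apply)
qed auto

text \<open>Were all cycle lengths odd, their product would be an odd exponent killing
  \<open>p\<close>. A cycle of \<open>p\<close> of even length is an odd permutation; conjugation by
  \<open>p\<close> merely rotates its list, so it commutes with \<open>p\<close>.\<close>

lemma ex_odd_commuting_of_even_order:
  assumes p: "p permutes S" "finite S" and ord: "\<And>N. p ^^ N = id \<Longrightarrow> even N"
  obtains \<tau> where "\<tau> permutes S" "\<not> evenperm \<tau>" "\<tau> \<circ> p = p \<circ> \<tau>"
proof -
  have perm: "permutation p"
    using p permutation_permutes by blast
  have "\<exists>x\<in>S. even (least_power p x)"
  proof (rule ccontr)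
    assume "\<not> ?thesis"
    then have "odd (\<Prod>x\<in>S. least_power p x)"
      using p(2) by (simp add: even_prod_iff)
    moreover have "p ^^ (\<Prod>x\<in>S. least_power p x) = id"
    proof
      fix x
      show "(p ^^ (\<Prod>x\<in>S. least_power p x)) x = id x"
      proof (cases "x \<in> S")
        case True
        then have "least_power p x dvd (\<Prod>x\<in>S. least_power p x)"
          using p(2) by (intro dvd_prodI)
        then show ?thesis
          by (simp add: least_power_dvd[OF perm])
      next
        case False
        then show ?thesis
          using permutes_not_in[OF permutes_funpow[OF p(1)]] by simp
      qed
    qed
    ultimately show False using ord by blast
  qed
  then obtain x where x: "x \<in> S" "even (least_power p x)" by blast
  let ?L = "least_power p x" and ?cs = "support p x"
  have L: "0 < ?L" "(p ^^ ?L) x = x"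
    using least_power_of_permutation[OF perm] by auto
  have cyc: "distinct ?cs" "?cs \<noteq> []"
    using cycle_of_permutation[OF perm] L(1) by auto
  have "set ?cs \<subseteq> S"
    using x(1) permutes_in_image[OF permutes_funpow[OF p(1)]] by auto
  then have "cycle_of_list ?cs permutes S"
    using cycle_permutes permutes_subset by blast
  moreover have "\<not> evenperm (cycle_of_list ?cs)"
    using evenperm_cycle_of_list[OF cyc] x(2) by simp
  moreover have "map p ?cs = rotate 1 ?cs"
  proof (rule nth_equalityI)
    fix k assume k: "k < length (map p ?cs)"
    then have "rotate 1 ?cs ! k = (p ^^ (Suc k mod ?L)) x"
      by (simp add: nth_rotate1 L(1))
    also have "\<dots> = (p ^^ Suc k) x"
      using k L by (cases "Suc k = ?L") auto
    finally show "map p ?cs ! k = rotate 1 ?cs ! k"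
      using k by simp
  qed simp
  then have "p \<circ> cycle_of_list ?cs \<circ> inv' p = cycle_of_list ?cs"
    using conjugation_of_cycle[OF cyc(1) permutes_bij[OF p(1)]]
      cycle_of_list_rotate_independent[OF cyc(1), of 1] by simp
  then have "p \<circ> cycle_of_list ?cs \<circ> inv' p \<circ> p = cycle_of_list ?cs \<circ> p"
    by simp
  then have "cycle_of_list ?cs \<circ> p = p \<circ> cycle_of_list ?cs"
    using permutes_inv_o(2)[OF p(1)] by (simp add: comp_assoc)
  ultimately show thesis by (rule that)
qed

lemma transpose_comp_permutes:
  assumes "p permutes S"
  shows "p \<circ> Transposition.transpose a b = Transposition.transpose (p a) (p b) \<circ> p"
  using inj_eq[OF permutes_inj[OF assms]] by (auto simp: fun_eq_iff Transposition.transpose_def)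

lemma transpose_commute_disjoint:
  "distinct [a, b, c, d] \<Longrightarrow> Transposition.transpose a b \<circ> Transposition.transpose c d
    = Transposition.transpose c d \<circ> Transposition.transpose a b"
  by (auto simp: fun_eq_iff Transposition.transpose_def)

text \<open>Two points outside one 3-cycle are either both fixed, and can be transposed, or one of
  them lies on a second 3-cycle; swapping the two cycles pointwise takes three transpositions, hence
  is odd.\<close>

lemma ex_odd_commuting_of_order_3:
  assumes p: "p permutes S" "finite S" and p3: "p ^^ 3 = id" "p \<noteq> id" and S: "5 \<le> card S"
  obtains \<tau> where "\<tau> permutes S" "\<not> evenperm \<tau>" "\<tau> \<circ> p = p \<circ> \<tau>"
proof -
  have ppp: "p (p (p x)) = x" for x
    using fun_cong[OF p3(1), of x] by (simp add: numeral_3_eq_3)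
  have inj: "p x = p y \<longleftrightarrow> x = y" for x y
    using inj_eq[OF permutes_inj[OF p(1)]] .
  have pS: "p x \<in> S \<longleftrightarrow> x \<in> S" for x
    by (rule permutes_in_image[OF p(1)])
  obtain x where x: "p x \<noteq> x"
    using p3(2) by (auto simp: fun_eq_iff)
  then have xS: "x \<in> S"
    using permutes_not_in[OF p(1)] by blast
  let ?C = "{x, p x, p (p x)}"
  have "card (S - ?C) \<ge> 2"
    using S diff_card_le_card_Diff[of ?C S] card_length[of "[x, p x, p (p x)]"] by simp
  then obtain A where "A \<subseteq> S - ?C" "card A = 2"
    by (meson obtain_subset_with_card_n)
  then obtain a b where ab: "a \<in> S - ?C" "b \<in> S - ?C" "a \<noteq> b"
    by (auto simp: card_2_iff)
  show thesis
  proof (cases "p a = a \<and> p b = b")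
    case True
    show ?thesis
    proof (rule that)
      show "Transposition.transpose a b permutes S"
        using ab by (intro permutes_swap_id) auto
      show "\<not> evenperm (Transposition.transpose a b)"
        using ab by (simp add: evenperm_swap)
      show "Transposition.transpose a b \<circ> p = p \<circ> Transposition.transpose a b"
        using transpose_comp_permutes[OF p(1), of a b] True by simp
    qed
  next
    case False
    then obtain y where y: "y \<in> S - ?C" "p y \<noteq> y"
      using ab by blast
    let ?t = "\<lambda>k. Transposition.transpose ((p ^^ k) x) ((p ^^ k) y)"
    let ?\<tau> = "?t 0 \<circ> (?t 1 \<circ> ?t 2)"
    have ne: "(p ^^ k) x \<noteq> (p ^^ k) y" for k
      using y(1) inj_eq[OF inj_fn[OF permutes_inj[OF p(1)]]] by auto
    have pt: "permutation (?t k)" for k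
      by (rule permutation_swap_id)
    show ?thesis
    proof (rule that)
      have "?t k permutes S" for k
        using xS y(1) permutes_in_image[OF permutes_funpow[OF p(1)]] by (intro permutes_swap_id) auto
      then show "?\<tau> permutes S"
        by (intro permutes_compose)
      show "\<not> evenperm ?\<tau>"
        using ne[of 0] ne[of 1] ne[of 2]
        by (simp only: evenperm_comp permutation_compose pt evenperm_swap) simp
      have dist: "distinct [x, p x, p (p x), y, p y, p (p y)]"
        using x y inj ppp by (simp, metis)
      \<comment> \<open>Conjugation by \<open>p\<close> permutes the three transpositions
        cyclically, as \<open>p\<close> has order 3; being disjoint, they commute.\<close>
      have "p \<circ> ?\<tau> = ?t 1 \<circ> (?t 2 \<circ> ?t 0) \<circ> p"
        using transpose_comp_permutes[OF p(1)] ppp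
        by (simp add: comp_assoc[symmetric] numeral_2_eq_2) (simp add: comp_assoc)
      moreover have "?t 1 \<circ> (?t 2 \<circ> ?t 0) = ?\<tau>"
      proof -
        have ne': "p x \<noteq> x" "p y \<noteq> x" "p x \<noteq> y" "p y \<noteq> y" "p (p x) \<noteq> x" "p (p y) \<noteq> x"
            "p (p x) \<noteq> y" "p (p y) \<noteq> y" "x \<noteq> y" "p x \<noteq> p y" "p (p x) \<noteq> p (p y)"
          using dist unfolding distinct.simps set_simps insert_iff by metis+
        have t20: "?t 2 \<circ> ?t 0 = ?t 0 \<circ> ?t 2"
          by (rule transpose_commute_disjoint) (simp add: numeral_2_eq_2 ne')
        have t10: "?t 1 \<circ> ?t 0 = ?t 0 \<circ> ?t 1"
          by (rule transpose_commute_disjoint) (simp add: ne')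
        show ?thesis unfolding t20 unfolding comp_assoc[symmetric] t10 ..
      qed
      ultimately show "?\<tau> \<circ> p = p \<circ> ?\<tau>"
        by simp
    qed
  qed
qed

lemma order_3_eq_cycle:
  assumes "p permutes S" "p ^^ 3 = id" "p x \<noteq> x" and rest: "\<And>y. y \<notin> {x, p x, p (p x)} \<Longrightarrow> p y = y"
  shows "p = cycle_of_list [x, p x, p (p x)]" "distinct [x, p x, p (p x)]"
proof -
  have ppp: "p (p (p x)) = x" for x
    using fun_cong[OF assms(2), of x] by (simp add: numeral_3_eq_3)
  have inj: "p x = p y \<longleftrightarrow> x = y" for x y
    using inj_eq[OF permutes_inj[OF assms(1)]] .
  show dist: "distinct [x, p x, p (p x)]"
    using assms(3) inj ppp by (auto, metis+)
  show "p = cycle_of_list [x, p x, p (p x)]"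
  proof
    fix y
    consider "y = x" | "y = p x" | "y = p (p x)" | "y \<notin> {x, p x, p (p x)}" by blast
    then show "p y = cycle_of_list [x, p x, p (p x)] y"
    proof cases
      case 4
      then have "p y = y" by (rule rest)
      with 4 show ?thesis by (simp add: Transposition.transpose_def)
    qed (use dist in \<open>auto simp: Transposition.transpose_def ppp\<close>)
  qed
qed

section \<open>Braided subspaces spanned by powers of the base point\<close>

text \<open>Read off the braiding, so that it depends on the vectors and not on exponents, which are
  determined only modulo the order of \<open>s\<close>.\<close>

definition diagonal_coeff :: "'x braiding \<Rightarrow> 'x \<Rightarrow> 'x \<Rightarrow> complex" where
  "diagonal_coeff c x y = Poly_Mapping.lookup (c x y) (y, x)"

context yd_setup
begin

text \<open>Integer representatives of the units by which one may divide exponents in the braiding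
  formula; inverting \<open>s\<close> is simply the exponent -1.\<close>

definition conj_powers :: "int set" where
  "conj_powers = {b. coprime b (int (ord s)) \<and> (\<exists>h\<in>carrier G. h \<otimes> s \<otimes> inv h = s [^] b)}"

abbreviation braiding where
  "braiding \<equiv> yd_braiding G s \<rho> g"

lemma one_in_conj_powers: "1 \<in> conj_powers"
  using s by (auto simp: conj_powers_def intro!: bexI[of _ \<one>])

lemma mult_in_conj_powers:
  assumes "a \<in> conj_powers" "b \<in> conj_powers"
  shows "a * b \<in> conj_powers"
proof -
  from assms obtain x y where x: "x \<in> carrier G" "x \<otimes> s \<otimes> inv x = s [^] a"
    and y: "y \<in> carrier G" "y \<otimes> s \<otimes> inv y = s [^] b"
    by (auto simp: conj_powers_def)
  have "(y \<otimes> x) \<otimes> s \<otimes> inv (y \<otimes> x) = y \<otimes> (x \<otimes> s \<otimes> inv x) \<otimes> inv y"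
    using x(1) y(1) s by (simp add: inv_mult_group m_assoc)
  also have "\<dots> = (y \<otimes> s \<otimes> inv y) [^] a"
    using y(1) s by (simp add: x(2) conj_int_pow)
  also have "\<dots> = s [^] (a * b)"
    using s by (simp add: y(2) int_pow_pow mult.commute)
  finally show ?thesis
    using assms x(1) y(1) by (auto simp: conj_powers_def intro!: bexI[of _ "y \<otimes> x"])
qed

lemma diagonal_coeff_powers:
  assumes "\<And>v. \<rho> s *v v = q *s v" "q ^ ord s = 1" "b \<in> conj_powers"
    and "p ^ ord s = 1" "q = p powi u" "[b * c = u] (mod int (ord s))"
  shows "diagonal_coeff braiding (s [^] (a :: int), k) (s [^] b, k) = p powi (a * c)"
  using yd_braiding_powers[OF assms(1,2) _ _ _ assms(4-6), where a = a and k = k] assms(3)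
  by (auto simp: conj_powers_def diagonal_coeff_def)

lemma diagonal_on_powers:
  assumes "\<And>v. \<rho> s *v v = q *s v" "q ^ ord s = 1" "B \<subseteq> conj_powers"
  shows "diagonal_on ((\<lambda>b. (s [^] b, k)) ` B) braiding (diagonal_coeff braiding)"
proof -
  have "braiding (s [^] a, k) (s [^] b, k) = Poly_Mapping.single ((s [^] b, k), (s [^] a, k))
      (diagonal_coeff braiding (s [^] a, k) (s [^] b, k))" if "b \<in> B" for a b :: int
  proof -
    have b: "b \<in> conj_powers" using that assms(3) by blast
    then obtain c where "[b * c = 1] (mod int (ord s))"
      unfolding conj_powers_def by (auto dest: cong_solve_coprime_int)
    then show ?thesis
      using yd_braiding_powers[OF assms(1,2) _ _ _ assms(2), where a = a and b = b and u = 1 and k = k] b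
      by (auto simp: conj_powers_def diagonal_coeff_def)
  qed
  then show ?thesis
    by (auto simp: diagonal_on_def)
qed

lemma powers_subset_yd_basis:
  assumes "B \<subseteq> conj_powers"
  shows "(\<lambda>b. (s [^] b, k)) ` B \<subseteq> yd_basis G s"
proof -
  have "s [^] b \<in> conj_class G s" if "b \<in> B" for b
  proof -
    from that assms obtain h where "h \<in> carrier G" "h \<otimes> s \<otimes> inv h = s [^] b"
      by (auto simp: conj_powers_def)
    then show ?thesis
      unfolding conj_class_def by (auto intro!: exI[of _ h])
  qed
  then show ?thesis by (auto simp: yd_basis_def)
qed

lemma not_nichols_finite_dim_trivial:
  assumes "\<And>v. \<rho> s *v v = v"
  shows "\<not> nichols_finite_dim (yd_basis G s :: ('a \<times> 'd) set) braiding"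
proof -
  define k :: 'd where "k = undefined"
  have q: "\<rho> s *v v = 1 *s v" "(1 :: complex) ^ ord s = 1" for v
    by (simp_all add: assms)
  have B: "{1} \<subseteq> conj_powers" by (simp add: one_in_conj_powers)
  have "diagonal_coeff braiding (s [^] (1 :: int), k) (s [^] (1 :: int), k) = 1"
    using diagonal_coeff_powers[OF q one_in_conj_powers q(2), where u = 1 and c = 1 and a = 1] by simp
  then show ?thesis
    by (intro not_nichols_finite_dim_single[OF diagonal_on_powers[OF q B] powers_subset_yd_basis[OF B]])
      auto
qed

lemma not_nichols_finite_dim_real:
  assumes q: "\<And>v. \<rho> s *v v = q *s v" "q ^ ord s = 1" and "q \<noteq> 1" "q \<noteq> -1"
    and real: "-1 \<in> conj_powers"
  shows "\<not> nichols_finite_dim (yd_basis G s :: ('a \<times> 'd) set) braiding"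
proof -
  define k :: 'd where "k = undefined"
  have q0: "q \<noteq> 0"
    using q(2) ord_pos by (auto simp: power_0_left)
  have q2: "q\<^sup>2 \<noteq> 1"
    using assms(3,4) by (simp add: power2_eq_1_iff)
  have B: "{1, -1} \<subseteq> conj_powers" using real one_in_conj_powers by simp
  let ?x = "(s [^] (1 :: int), k)" and ?y = "(s [^] (-1 :: int), k)"
  note c = diagonal_coeff_powers[OF q _ q(2), where k = k and u = 1]
  have Q: "diagonal_coeff braiding ?x ?x = q" "diagonal_coeff braiding ?y ?y = q"
      "diagonal_coeff braiding ?x ?y = inverse q" "diagonal_coeff braiding ?y ?x = inverse q"
    using c[OF one_in_conj_powers, where c = 1 and a = 1] c[OF one_in_conj_powers, where c = 1 and a = "-1"]
      c[OF real, where c = "-1" and a = 1] c[OF real, where c = "-1" and a = "-1"]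
    by (simp_all add: power_int_minus)
  have neq: "?x \<noteq> ?y"
  proof
    assume "?x = ?y"
    then have "int (ord s) dvd 2"
      using int_pow_eq[OF s, of 1 "-1"] by (simp add: dvd_diff_commute)
    then obtain e where "2 = ord s * e"
      by (metis dvd_def int_dvd_int_iff of_nat_numeral)
    then have "q\<^sup>2 = (q ^ ord s) ^ e"
      by (metis power_mult)
    then show False
      using q2 q(2) by simp
  qed
  \<comment> \<open>The degree of \<open>s\<close> plus that of its inverse has self-braiding
    \<open>q * q * q powi (-2)\<close>; the commutator survives because \<open>q powi (-2)\<close>
    is not 1.\<close>
  show ?thesis
    by (rule not_nichols_finite_dim_pair[OF diagonal_on_powers[OF q B, of k]
          powers_subset_yd_basis[OF B], where a = ?x and b = ?y and m = 1])
      (use neq q0 q2 \<open>q \<noteq> 1\<close> in \<open>auto simp: Q le_Suc_eq power2_eq_square field_simps\<close>)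
qed

lemma not_nichols_finite_dim_twice:
  assumes q: "\<And>v. \<rho> s *v v = q *s v" "q ^ ord s = 1" and "q \<noteq> 1"
    and \<epsilon>: "\<epsilon> = 1 \<or> \<epsilon> = -1" "2 * \<epsilon> \<in> conj_powers" and ord: "odd (ord s)" "ord s \<noteq> 3"
  shows "\<not> nichols_finite_dim (yd_basis G s :: ('a \<times> 'd) set) braiding"
proof -
  define k :: 'd where "k = undefined"
  have "(2 * \<epsilon>) * (2 * \<epsilon>) \<in> conj_powers"
    by (rule mult_in_conj_powers[OF \<epsilon>(2,2)])
  then have four: "4 \<in> conj_powers" using \<epsilon>(1) by auto
  have B: "{1, 2 * \<epsilon>, 4} \<subseteq> conj_powers"
    using one_in_conj_powers \<epsilon>(2) four by simp
  \<comment> \<open>\<open>m\<close> is the inverse of 2 modulo the odd order, so \<open>p\<close>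
    below is a fourth root of \<open>q\<close>.\<close>
  define m where "m = Suc (ord s) div 2"
  have m: "2 * m = Suc (ord s)" using ord(1) by (simp add: m_def)
  define p where "p = q ^ (m * m)"
  have "p ^ ord s = (q ^ ord s) ^ (m * m)"
    by (simp add: p_def mult.commute flip: power_mult)
  then have p: "p ^ ord s = 1" using q(2) by simp
  have "4 * (m * m) = (2 * m) * (2 * m)" by simp
  also have "\<dots> = ord s * (ord s + 2) + 1" unfolding m by (simp add: algebra_simps)
  finally have mm: "4 * (m * m) = ord s * (ord s + 2) + 1" .
  have "p ^ 4 = q ^ (4 * (m * m))"
    by (simp add: p_def mult.commute flip: power_mult)
  also have "\<dots> = (q ^ ord s) ^ (ord s + 2) * q"
    unfolding mm by (simp only: power_add power_one_right power_mult)
  finally have "p ^ 4 = (q ^ ord s) ^ (ord s + 2) * q" .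
  then have qp: "q = p powi 4" using q(2) by simp
  obtain d where d: "\<And>i. p powi i = 1 \<longleftrightarrow> int d dvd i" "0 < d" "d dvd ord s"
    using ex_root_order[OF p ord_pos] by blast
  have "odd d" using d(3) ord(1) by (meson dvd_trans)
  have "p \<noteq> 1" using qp \<open>q \<noteq> 1\<close> by auto
  then have "d \<noteq> 1" using d(1)[of 1] by auto
  have p0: "p \<noteq> 0" using p ord_pos by (auto simp: power_0_left)
  have "ord s \<noteq> 1" using q(2) \<open>q \<noteq> 1\<close> by auto
  then have "4 \<le> ord s"
    using ord by presburger
  \<comment> \<open>The exponents \<open>1\<close>, \<open>2 * \<epsilon>\<close> and
    \<open>4\<close> differ by 1, 2, 3 or 6 up to sign, so the three letters are distinct; order 3
    would identify \<open>1\<close> and \<open>4\<close>.\<close>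
  then have "\<not> int (ord s) dvd 3" "\<not> int (ord s) dvd 2" "\<not> int (ord s) dvd 1"
    using zdvd_imp_le[of "int (ord s)"] by fastforce+
  moreover from this have "\<not> int (ord s) dvd 2 * 3"
    using ord(1) by (subst coprime_dvd_mult_right_iff) auto
  ultimately have ndvd: "\<not> int (ord s) dvd 6" "\<not> int (ord s) dvd 3" "\<not> int (ord s) dvd 2" "\<not> int (ord s) dvd 1"
    by simp_all
  let ?x = "\<lambda>i :: int. (s [^] i, k)"
  have neq: "?x 1 \<noteq> ?x (2 * \<epsilon>)" "?x (2 * \<epsilon>) \<noteq> ?x 4" "?x 1 \<noteq> ?x 4"
    using ndvd \<epsilon>(1) by (auto simp: int_pow_eq[OF s])
  \<comment> \<open>With \<open>q = p powi 4\<close>, dividing 4 by the exponents \<open>1\<close>,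
    \<open>2 * \<epsilon>\<close>, \<open>4\<close> gives the integers \<open>4\<close>,
    \<open>2 * \<epsilon>\<close>, \<open>1\<close>; this is why a fourth root was taken.\<close>
  note c = diagonal_coeff_powers[OF q _ p qp, where k = k]
  have Q: "diagonal_coeff braiding (?x a) (?x 1) = p powi (a * 4)"
      "diagonal_coeff braiding (?x a) (?x (2 * \<epsilon>)) = p powi (a * (2 * \<epsilon>))"
      "diagonal_coeff braiding (?x a) (?x 4) = p powi (a * 1)" for a
    using \<epsilon>(1) c[OF one_in_conj_powers, where c = 4] c[OF \<epsilon>(2), where c = "2 * \<epsilon>"]
      c[OF four, where c = 1] by auto
  show ?thesis
    by (rule not_nichols_finite_dim_powers_of_two[OF diagonal_on_powers[OF q B, of k]
          powers_subset_yd_basis[OF B] _ _ _ neq d(1) p0 \<open>odd d\<close> \<open>d \<noteq> 1\<close> \<epsilon>(1)])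
      (use \<epsilon>(1) in \<open>auto simp: Q\<close>)
qed

end

section \<open>Conjugacy in the alternating group\<close>

lemma alt_group_nat_pow: "p [^]\<^bsub>alt_group n\<^esub> (k :: nat) = p ^^ k"
  by (induction k) (simp_all add: alt_group_one alt_group_mult nat_pow_def funpow_Suc_right del: funpow.simps)

lemma finite_conj_class_alt_group:
  assumes "p \<in> carrier (alt_group n)"
  shows "finite (conj_class (alt_group n) p)"
proof (rule finite_subset)
  interpret group "alt_group n" by (rule alt_group_is_group)
  have "conj_class (alt_group n) p \<subseteq> carrier (alt_group n)"
    using assms by (auto simp: conj_class_def)
  then show "conj_class (alt_group n) p \<subseteq> {q. q permutes {1..n}}"
    using alt_group_carrier by blast
qed (simp add: finite_permutations)

lemma alt_group_conj_eqI:
  assumes h: "h permutes {1..n}" "evenperm h" and "p \<in> carrier (alt_group n)"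
    and "h \<circ> p = r \<circ> h"
  shows "h \<in> carrier (alt_group n)" "h \<otimes>\<^bsub>alt_group n\<^esub> p \<otimes>\<^bsub>alt_group n\<^esub> inv\<^bsub>alt_group n\<^esub> h = r"
proof -
  show *: "h \<in> carrier (alt_group n)"
    using h by (simp add: alt_group_carrier)
  have "h \<circ> p \<circ> inv' h = r"
    unfolding assms(4) comp_assoc permutes_inv_o(1)[OF h(1)] by simp
  with * show "h \<otimes>\<^bsub>alt_group n\<^esub> p \<otimes>\<^bsub>alt_group n\<^esub> inv\<^bsub>alt_group n\<^esub> h = r"
    by (simp add: alt_group_mult alt_group_inv_equality)
qed

lemma comp_funpow_commute:
  assumes "f \<circ> p = r \<circ> f"
  shows "f \<circ> (p ^^ k) = (r ^^ k) \<circ> f"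
proof -
  have "f (p x) = r (f x)" for x
    using fun_cong[OF assms, of x] by simp
  then have "f ((p ^^ k) x) = (r ^^ k) (f x)" for x
    by (induction k) auto
  then show ?thesis
    by (simp add: fun_eq_iff)
qed

text \<open>A moved point outside the 3-cycle would bring along its image as a second such point,
  for which there is no room; so the permutation is a single 3-cycle, and in degree 4 it remains to
  find an even relabelling.\<close>

lemma alt_group_order_3_small:
  assumes p: "p \<in> carrier (alt_group n)" "p ^^ 3 = id" "p \<noteq> id" and n: "n < 5"
  shows "n = 3 \<and> p \<in> {cycle_of_list [1, 2, 3], cycle_of_list [1, 3, 2]}
    \<or> n = 4 \<and> p \<in> conj_class (alt_group 4) (cycle_of_list [1, 2, 3])
        \<union> conj_class (alt_group 4) (cycle_of_list [1, 3, 2])"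
proof -
  have perm: "p permutes {1..n}" using p(1) by (simp add: alt_group_carrier)
  have ppp: "p (p (p x)) = x" for x
    using fun_cong[OF p(2), of x] by (simp add: numeral_3_eq_3)
  have inj: "p x = p y \<longleftrightarrow> x = y" for x y
    using inj_eq[OF permutes_inj[OF perm]] .
  have pS: "p x \<in> {1..n} \<longleftrightarrow> x \<in> {1..n}" for x
    by (rule permutes_in_image[OF perm])
  obtain x where x: "p x \<noteq> x"
    using p(3) by (auto simp: fun_eq_iff)
  then have xS: "x \<in> {1..n}"
    using permutes_not_in[OF perm] by blast
  let ?C = "{x, p x, p (p x)}"
  have CS: "?C \<subseteq> {1..n}" using xS pS by simp
  have C3: "card ?C = 3"
  proof -
    have "p (p x) \<noteq> x" using x ppp inj by metis
    moreover have "p (p x) \<noteq> p x" using x inj by simp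
    ultimately show ?thesis using x by simp
  qed
  have "card ({1..n} - ?C) = n - 3"
    using CS C3 by (simp add: card_Diff_subset)
  moreover have n34: "n = 3 \<or> n = 4"
    using card_mono[OF _ CS] C3 n by simp linarith
  moreover have fixed: "p y = y" if y: "y \<notin> ?C" for y
  proof (rule ccontr)
    assume py: "p y \<noteq> y"
    then have "y \<in> {1..n}" using permutes_not_in[OF perm] by blast
    moreover have "p y \<notin> ?C" using y inj ppp by (metis insert_iff singletonD)
    ultimately have "{y, p y} \<subseteq> {1..n} - ?C" using y pS by auto
    then have "card {y, p y} \<le> card ({1..n} - ?C)" by (intro card_mono) auto
    with \<open>card ({1..n} - ?C) = n - 3\<close> py n show False by simp
  qed
  note cyc = order_3_eq_cycle[OF perm p(2) x fixed]
  from n34 show ?thesis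
  proof
    assume n: "n = 3"
    then have "?C = {1..3}"
      using CS C3 by (intro card_subset_eq) auto
    then have "1 \<in> ?C" by auto
    then have one: "p 1 \<noteq> 1"
      using x ppp inj by (metis insertE singletonD)
    have fixed1: "p y = y" if "y \<notin> {1, p 1, p (p 1)}" for y
    proof (rule fixed)
      show "y \<notin> ?C" using that \<open>1 \<in> ?C\<close> ppp by (metis insert_iff singletonD)
    qed
    note cyc1 = order_3_eq_cycle[OF perm p(2) one fixed1]
    have "p 1 \<in> {1..3}" "p (p 1) \<in> {1..3}"
      using pS[of 1] pS[of "p 1"] n by auto
    then have "[1, p 1, p (p 1)] = [1, 2, 3] \<or> [1, p 1, p (p 1)] = [1, 3, 2]"
      using cyc1(2) by auto
    then have "p = cycle_of_list [1, 2, 3] \<or> p = cycle_of_list [1, 3, 2]"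
      using cyc1(1) by metis
    then show ?thesis using n by blast
  next
    assume n: "n = 4"
    with \<open>card ({1..n} - ?C) = n - 3\<close> obtain w where w: "{1..n} - ?C = {w}"
      by (auto simp: card_1_singleton_iff)
    define \<sigma> :: "nat \<Rightarrow> nat" where
      "\<sigma> i = (if i = 1 then x else if i = 2 then p x else if i = 3 then p (p x) else if i = 4 then w else i)" for i
    have "\<sigma> ` {1..4} = {1..n}"
    proof -
      have "{1..4} = {1, 2, 3, 4 :: nat}" by auto
      then have "\<sigma> ` {1..4} = ?C \<union> {w}" by (auto simp: \<sigma>_def)
      with w CS show ?thesis by blast
    qed
    then have \<sigma>: "\<sigma> permutes {1..4}"
      using n by (intro bij_imp_permutes) (auto simp: bij_betw_def \<sigma>_def intro: eq_card_imp_inj_on)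
    have in_class: "p \<in> conj_class (alt_group 4) (cycle_of_list cs)"
      if "\<tau> permutes {1..4}" "evenperm \<tau>" "distinct cs" "map \<tau> cs = [x, p x, p (p x)]" for \<tau> cs
    proof -
      have "\<tau> \<circ> cycle_of_list cs \<circ> inv' \<tau> = p"
        unfolding conjugation_of_cycle[OF that(3) permutes_bij[OF that(1)]] that(4)
        by (rule cyc(1)[symmetric])
      moreover have "\<tau> \<in> carrier (alt_group 4)" using that by (simp add: alt_group_carrier)
      ultimately show ?thesis
        unfolding conj_class_def
        by (auto simp: alt_group_mult alt_group_inv_equality intro!: exI[of _ \<tau>])
    qed
    show ?thesis
    proof (cases "evenperm \<sigma>")
      case True
      then have "p \<in> conj_class (alt_group 4) (cycle_of_list [1, 2, 3])"
        by (intro in_class[OF \<sigma>]) (auto simp: \<sigma>_def)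
      with n show ?thesis by blast
    next
      case False
      have "permutation \<sigma>"
        using \<sigma> permutation_permutes by blast
      \<comment> \<open>Exchanging 2 and 3 first makes the relabelling even, at the cost of starting
        from the other 3-cycle.\<close>
      let ?\<tau> = "\<sigma> \<circ> Transposition.transpose 2 3"
      have "evenperm ?\<tau>"
        using False \<open>permutation \<sigma>\<close>
        by (simp add: evenperm_comp permutation_swap_id evenperm_swap del: o_apply)
      moreover have "?\<tau> permutes {1..4}"
        by (intro permutes_compose[OF _ \<sigma>] permutes_swap_id) auto
      ultimately have "p \<in> conj_class (alt_group 4) (cycle_of_list [1, 3, 2])"
        by (intro in_class) (auto simp: \<sigma>_def Transposition.transpose_def)
      with n show ?thesis by blast
    qed
  qed
qed

text \<open>The exponents \<open>N - 1\<close> and \<open>2 * (N - 1)\<close> are natural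
  representatives of -1 and -2. A 3-cycle in degree 3 or 4 is not conjugate to its inverse in the
  alternating group, so no alternative would hold for it.\<close>

lemma alt_group_conj_powers:
  assumes \<pi>: "\<pi> \<in> carrier (alt_group n)"
    and n4: "n = 4 \<Longrightarrow> \<pi> \<notin> conj_class (alt_group 4) (cycle_of_list [1, 2, 3])
        \<union> conj_class (alt_group 4) (cycle_of_list [1, 3, 2])"
    and n3: "n = 3 \<Longrightarrow> \<pi> \<notin> {cycle_of_list [1, 2, 3], cycle_of_list [1, 3, 2]}"
  defines "N \<equiv> group.ord (alt_group n) \<pi>"
  assumes N0: "0 < N"
  shows "(\<exists>h. h permutes {1..n} \<and> evenperm h \<and> h \<circ> \<pi> = (\<pi> ^^ (N - 1)) \<circ> h)
    \<or> odd N \<and> N \<noteq> 3 \<and> (\<exists>h. h permutes {1..n} \<and> evenperm h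
        \<and> (h \<circ> \<pi> = (\<pi> ^^ 2) \<circ> h \<or> h \<circ> \<pi> = (\<pi> ^^ (2 * (N - 1))) \<circ> h))"
proof -
  interpret group "alt_group n" by (rule alt_group_is_group)
  have pow: "\<pi> ^^ k = id \<longleftrightarrow> N dvd k" for k
    using pow_eq_id[OF \<pi>, of k] by (simp add: alt_group_nat_pow alt_group_one N_def)
  have perm: "\<pi> permutes {1..n}" using \<pi> by (simp add: alt_group_carrier)
  have pN: "\<pi> ^^ N = id" by (simp add: pow)
  have "coprime (N - 1) N" using N0 by (rule coprime_diff_one_left_nat)
  then obtain \<sigma> where \<sigma>: "\<sigma> permutes {1..n}" "\<sigma> \<circ> \<pi> = (\<pi> ^^ (N - 1)) \<circ> \<sigma>"
    using ex_permutes_conj_power[OF perm _ pN N0] by blast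
  have permutation: "permutation f" if "f permutes {1..n}" for f
    using that permutation_permutes by blast
  show ?thesis
  proof (cases "evenperm \<sigma> \<or> (\<exists>\<tau>. \<tau> permutes {1..n} \<and> \<not> evenperm \<tau> \<and> \<tau> \<circ> \<pi> = \<pi> \<circ> \<tau>)")
    case True
    then have "\<exists>h. h permutes {1..n} \<and> evenperm h \<and> h \<circ> \<pi> = (\<pi> ^^ (N - 1)) \<circ> h"
    proof (cases "evenperm \<sigma>")
      case False
      with True obtain \<tau> where \<tau>: "\<tau> permutes {1..n}" "\<not> evenperm \<tau>" "\<tau> \<circ> \<pi> = \<pi> \<circ> \<tau>" by blast
      have "\<sigma> \<circ> \<tau> \<circ> \<pi> = (\<pi> ^^ (N - 1)) \<circ> (\<sigma> \<circ> \<tau>)"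
        by (simp add: comp_assoc \<tau>(3)) (simp add: \<sigma>(2) flip: comp_assoc)
      then show ?thesis
        using False \<sigma>(1) \<tau>(1,2)
        by (intro exI[of _ "\<sigma> \<circ> \<tau>"]) (auto intro: permutes_compose simp: evenperm_comp permutation)
    qed (use \<sigma> in blast)
    then show ?thesis by blast
  next
    case False
    then have no_odd: "evenperm \<tau>" if "\<tau> permutes {1..n}" "\<tau> \<circ> \<pi> = \<pi> \<circ> \<tau>" for \<tau>
      using that by blast
    have "odd N"
    proof
      assume "even N"
      then have "even k" if "\<pi> ^^ k = id" for k
        using that pow by (meson dvd_trans)
      then obtain \<tau> where "\<tau> permutes {1..n}" "\<not> evenperm \<tau>" "\<tau> \<circ> \<pi> = \<pi> \<circ> \<tau>"
        using ex_odd_commuting_of_even_order[OF perm] by (metis finite_atLeastAtMost)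
      then show False using no_odd by blast
    qed
    have "N \<noteq> 3"
    proof
      assume N3: "N = 3"
      then have p3: "\<pi> ^^ 3 = id" "\<pi> \<noteq> id"
        using pow[of 3] pow[of 1] by auto
      have "n < 5"
      proof (rule ccontr)
        assume "\<not> n < 5"
        then obtain \<tau> where "\<tau> permutes {1..n}" "\<not> evenperm \<tau>" "\<tau> \<circ> \<pi> = \<pi> \<circ> \<tau>"
          using ex_odd_commuting_of_order_3[OF perm _ p3] by (metis card_atLeastAtMost diff_Suc_1 finite_atLeastAtMost not_less)
        then show False using no_odd by blast
      qed
      from alt_group_order_3_small[OF \<pi> p3 this] show False
        using n3 n4 by blast
    qed
    have "coprime 2 N" using \<open>odd N\<close> by simp
    then obtain \<sigma>2 where \<sigma>2: "\<sigma>2 permutes {1..n}" "\<sigma>2 \<circ> \<pi> = (\<pi> ^^ 2) \<circ> \<sigma>2"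
      using ex_permutes_conj_power[OF perm _ pN N0] by blast
    have "\<exists>h. h permutes {1..n} \<and> evenperm h
        \<and> (h \<circ> \<pi> = (\<pi> ^^ 2) \<circ> h \<or> h \<circ> \<pi> = (\<pi> ^^ (2 * (N - 1))) \<circ> h)"
    proof (cases "evenperm \<sigma>2")
      case False
      \<comment> \<open>Both \<open>\<sigma>2\<close> and \<open>\<sigma>\<close> are odd here, so
        their product is even.\<close>
      have "\<sigma>2 \<circ> \<sigma> \<circ> \<pi> = \<sigma>2 \<circ> (\<pi> ^^ (N - 1)) \<circ> \<sigma>"
        by (simp add: comp_assoc \<sigma>(2))
      also have "\<dots> = ((\<pi> ^^ 2) ^^ (N - 1)) \<circ> \<sigma>2 \<circ> \<sigma>"
        by (simp only: comp_funpow_commute[OF \<sigma>2(2)])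
      also have "\<dots> = (\<pi> ^^ (2 * (N - 1))) \<circ> (\<sigma>2 \<circ> \<sigma>)"
        by (simp only: funpow_mult comp_assoc mult.commute)
      finally show ?thesis
        using False \<open>\<not> (evenperm \<sigma> \<or> _)\<close> \<sigma>(1) \<sigma>2(1)
        by (intro exI[of _ "\<sigma>2 \<circ> \<sigma>"]) (auto intro: permutes_compose simp: evenperm_comp permutation)
    qed (use \<sigma>2 in blast)
    with \<open>odd N\<close> \<open>N \<noteq> 3\<close> show ?thesis by blast
  qed
qed

text \<open>The 3-cycles of degree 3 are excluded along with those of degree 4: the alternating
  group on 3 letters is abelian, so a nontrivial \<open>\<rho>\<close> gives a braided line whose
  Nichols algebra has dimension 3, although the order is odd.\<close>

theorem theorem2p3:
  fixes n :: nat and \<pi> :: "nat \<Rightarrow> nat"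
    and \<rho> :: "(nat \<Rightarrow> nat) \<Rightarrow> complex^'d::finite^'d"
    and g :: "(nat \<Rightarrow> nat) \<Rightarrow> (nat \<Rightarrow> nat)"
  assumes "\<pi> \<in> carrier (alt_group n)"
    and "irreducible_rep ((alt_group n)\<lparr>carrier := centralizer (alt_group n) \<pi>\<rparr>) \<rho>"
    and "conj_section (alt_group n) \<pi> g"
    and "n = 4 \<Longrightarrow> \<pi> \<notin> conj_class (alt_group 4) (cycle_of_list [1, 2, 3])
                  \<union> conj_class (alt_group 4) (cycle_of_list [1, 3, 2])"
    and "n = 3 \<Longrightarrow> \<pi> \<notin> {cycle_of_list [1, 2, 3], cycle_of_list [1, 3, 2]}"
    and "nichols_finite_dim (yd_basis (alt_group n) \<pi> :: ((nat \<Rightarrow> nat) \<times> 'd) set)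
           (yd_braiding (alt_group n) \<pi> \<rho> g)"
  shows "even (group.ord (alt_group n) \<pi>) \<and> acting_scalar (\<rho> \<pi>) = -1"
proof -
  interpret group "alt_group n" by (rule alt_group_is_group)
  let ?N = "ord \<pi>"
  obtain k where "\<pi> ^^ k = id" "0 < k"
    using permutation_is_nilpotent[OF alt_group_carrier'[OF assms(1)]] by blast
  then have N0: "0 < ?N"
    using pow_eq_id[OF assms(1), of k] by (auto simp: alt_group_nat_pow alt_group_one intro: Nat.gr0I)
  interpret yd_setup "alt_group n" \<pi> \<rho> g
    by unfold_locales (use assms(1-3) N0 finite_conj_class_alt_group in auto)
  obtain q where q: "\<And>v. \<rho> \<pi> *v v = q *s v" "q ^ ?N = 1" "acting_scalar (\<rho> \<pi>) = q"
    using rep_scalar by blast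
  have "q \<noteq> 1"
    using not_nichols_finite_dim_trivial assms(6) q(1) by auto
  have int_pow: "\<pi> ^^ k = \<pi> [^]\<^bsub>alt_group n\<^esub> b" if "int ?N dvd int k - b" for k :: nat and b :: int
    using that int_pow_eq[OF assms(1), of "int k" b]
    by (simp add: int_pow_int alt_group_nat_pow dvd_diff_commute)
  have conj: "b \<in> conj_powers" if "h permutes {1..n}" "evenperm h" "h \<circ> \<pi> = (\<pi> ^^ k) \<circ> h"
      "int ?N dvd int k - b" "coprime b (int ?N)" for h k b
    using alt_group_conj_eqI[OF that(1,2) assms(1) that(3)] that(4,5)
    by (auto simp: conj_powers_def int_pow intro!: bexI[of _ h])
  consider h where "h permutes {1..n}" "evenperm h" "h \<circ> \<pi> = (\<pi> ^^ (?N - 1)) \<circ> h"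
    | h where "odd ?N" "?N \<noteq> 3" "h permutes {1..n}" "evenperm h"
        "h \<circ> \<pi> = (\<pi> ^^ 2) \<circ> h \<or> h \<circ> \<pi> = (\<pi> ^^ (2 * (?N - 1))) \<circ> h"
    using alt_group_conj_powers[OF assms(1,4,5) N0] by blast
  then show ?thesis
  proof cases
    case 1
    have "-1 \<in> conj_powers"
      using N0 by (intro conj[OF 1]) (auto simp: of_nat_diff)
    then have "q = -1"
      using not_nichols_finite_dim_real[OF q(1,2) \<open>q \<noteq> 1\<close>] assms(6) by blast
    moreover from this have "even ?N"
      using q(2) by (metis neg_one_odd_power one_neq_neg_one)
    ultimately show ?thesis using q(3) by simp
  next
    case 2
    have "int ?N dvd int (2 * (?N - 1)) - (-2)"
      using N0 by (simp add: of_nat_diff)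
    then have "2 * 1 \<in> conj_powers \<or> 2 * (-1) \<in> conj_powers"
      using 2 conj[OF 2(3,4), of 2 2] conj[OF 2(3,4), of "2 * (?N - 1)" "-2"] by auto
    then obtain \<epsilon> :: int where "\<epsilon> = 1 \<or> \<epsilon> = -1" "2 * \<epsilon> \<in> conj_powers" by blast
    then show ?thesis
      using not_nichols_finite_dim_twice[OF q(1,2) \<open>q \<noteq> 1\<close> _ _ 2(1,2)] assms(6) by blast
  qed
qed

end
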